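(* Let $n\ge 0$, let $C$ be an $n$-precategory, and let $C_{n+1}$ be a set equipped with maps $\partial^-_n,\partial^+_n:C_{n+1}\to C_n$ making $(C_0,\dots,C_n,C_{n+1})$ an $(n+1)$-globular set. Let $C^*_{n+1}$ be the set of $(n+1)$-cells of the free $(n+1)$-precategory on $(C,C_{n+1})$. Then every $u\in C^*_{n+1}$ can be written in a unique way as $$u=u_1\ast_n u_2\ast_n\cdots\ast_n u_k$$ with $k\ge 0$ (the case $k=0$ meaning that $u$ is an identity on an $n$-cell), where each $u_i$ is of the form $$u_i=v^i_n\ast_{n-1}(\cdots\ast_2(v^i_2\ast_1(v^i_1\ast_0 A^i\ast_0 w^i_1)\ast_1 w^i_2)\ast_2\cdots)\ast_{n-1}w^i_n$$ with $A^i\in C_{n+1}$ and $v^i_j,w^i_j\in C_j$ for $1\le j\le n$. (Uniqueness means that $k$, the $A^i$, the $v^i_j$ and the $w^i_j$ are uniquely determined by $u$.)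
   Context: **Precategories.** For $n\ge 0$, an $n$-globular set is a family of sets $C_0,\dots,C_n$ with maps $\partial^-_i,\partial^+_i:C_{i+1}\to C_i$ ($0\le i<n$) such that $\partial^\epsilon_i\partial^-_{i+1}=\partial^\epsilon_i\partial^+_{i+1}$ for $\epsilon\in\{-,+\}$; $\partial^\epsilon_i$ also denotes iterated source/target down to dimension $i$, and $\partial^\epsilon$ the one-step source/target. Cells $u_1,\dots,u_p$ of dimensions $>i$ are $i$-composable if $\partial^+_i(u_j)=\partial^-_i(u_{j+1})$ for all $j$. An $n$-precategory is an $n$-globular set $C$ with identities $\mathrm{id}:C_{k-1}\to C_k$ ($0<k\le n$) and compositions $u\ast_i v\in C_{\max(k,l)}$ for $u\in C_k$, $v\in C_l$ $i$-composable with $0<k,l\le n$ and $i=\min(k,l)-1$, such that: (i) $\partial^-(\mathrm{id}_u)=u=\partial^+(\mathrm{id}_u)$; (ii) $\partial^\epsilon(u\ast_i v)$ equals $u\ast_i\partial^\epsilon(v)$ if $k<l$, $\partial^\epsilon(u)\ast_i v$ if $k>l$, and, if $k=l$, $\partial^-(u)$ for $\epsilon=-$ and $\partial^+(v)$ for $\epsilon=+$; (iii) for $u\in C_{k-1}$, $v\in C_l$, $i=\min(k,l)-1$: $\mathrm{id}_u\ast_i v=v$ if $k\le l$ and $\mathrm{id}_u\ast_i v=\mathrm{id}_{u\ast_i v}$ if $k>l$, and symmetrically for identities on the right; (iv) $(u\ast_i v)\ast_i w=u\ast_i(v\ast_i w)$ whenever both sides are defined; (v) for $i<j$, $u\in C_{i+1}$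 and $v\ast_j v'$ defined with $u,v$ $i$-composable, $u\ast_i(v\ast_j v')=(u\ast_i v)\ast_j(u\ast_i v')$, and symmetrically on the right. Morphisms ($n$-prefunctors) are morphisms of globular sets preserving identities and compositions. **Free $(n+1)$-precategory.** Let $\mathbf{PCat}_n^+$ be the category of pairs $(C,C_{n+1})$ as in the claim (an $n$-precategory with a set of $(n+1)$-globes over it, without composition for these). The free $(n+1)$-precategory on $(C,C_{n+1})$ is its image under the left adjoint of the forgetful functor $\mathbf{PCat}_{n+1}\to\mathbf{PCat}_n^+$, which sends $D$ to (the $n$-precategory of its cells of dimension $\le n$, its set $D_{n+1}$). Its underlying $n$-precategory is $C$; its $(n+1)$-cells are formal composites of elements of $C_{n+1}$, identities on $n$-cells and lower-dimensional cells of $C$, modulo the axioms of precategories. Elements of $C_{n+1}$ are identified with their images. *)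

theory Defs
  imports Main "HOL-Library.FuncSet"
begin

section \<open>Precategories\<close>

datatype sgn = Minus | Plus

text \<open>
  Cells of all dimensions share one type; \<open>cells C k\<close> is the set of \<open>k\<close>-cells. The sets for different
  \<open>k\<close> may overlap, so every operation takes the dimensions of its arguments:
  \<open>bd C e k\<close> maps \<open>(k+1)\<close>-cells to \<open>k\<close>-cells, \<open>idn C k\<close> maps \<open>k\<close>-cells to \<open>(k+1)\<close>-cells, and
  \<open>cmp C k l u v\<close> is \<open>u *\<^sub>i v\<close> for a \<open>k\<close>-cell \<open>u\<close> and an \<open>l\<close>-cell \<open>v\<close>, where \<open>i = min k l - 1\<close>.
  Being an \<open>n\<close>-globular set or an \<open>n\<close>-precategory only constrains the data in dimensions up to \<open>n\<close>.
  Hence truncation is the identity on these records, and a pair \<open>(C, C\<^sub>n\<^sub>+\<^sub>1)\<close> of the category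
  \<open>PCat\<^sub>n\<^sup>+\<close> is a single record which is an \<open>n\<close>-precategory and an \<open>(n+1)\<close>-globular set.
\<close>

record 'a precat =
  cells :: "nat \<Rightarrow> 'a set"
  bd :: "sgn \<Rightarrow> nat \<Rightarrow> 'a \<Rightarrow> 'a"
  idn :: "nat \<Rightarrow> 'a \<Rightarrow> 'a"
  cmp :: "nat \<Rightarrow> nat \<Rightarrow> 'a \<Rightarrow> 'a \<Rightarrow> 'a"

text \<open>\<open>bds C e i k\<close> is the iterated boundary from dimension \<open>k\<close> down to dimension \<open>i\<close>.\<close>

primrec bds :: "'a precat \<Rightarrow> sgn \<Rightarrow> nat \<Rightarrow> nat \<Rightarrow> 'a \<Rightarrow> 'a" where
  "bds C e i 0 u = u"
| "bds C e i (Suc k) u = (if i \<le> k then bds C e i k (bd C e k u) else u)"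

definition composable :: "'a precat \<Rightarrow> nat \<Rightarrow> nat \<Rightarrow> 'a \<Rightarrow> 'a \<Rightarrow> bool" where
  "composable C k l u v \<longleftrightarrow>
     0 < k \<and> 0 < l \<and> u \<in> cells C k \<and> v \<in> cells C l \<and>
     bds C Plus (min k l - 1) k u = bds C Minus (min k l - 1) l v"

locale globular_set =
  fixes n :: nat and C :: "'a precat"
  assumes bd_cell: "k < n \<Longrightarrow> u \<in> cells C (Suc k) \<Longrightarrow> bd C e k u \<in> cells C k"
    and globular: "Suc k < n \<Longrightarrow> u \<in> cells C (Suc (Suc k)) \<Longrightarrow>
      bd C e k (bd C Minus (Suc k) u) = bd C e k (bd C Plus (Suc k) u)"

locale precategory = globular_set n C for n :: nat and C :: "'a precat" +
  assumes idn_cell: "k < n \<Longrightarrow> u \<in> cells C k \<Longrightarrow> idn C k u \<in> cells C (Suc k)"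
    and cmp_cell: "k \<le> n \<Longrightarrow> l \<le> n \<Longrightarrow> composable C k l u v \<Longrightarrow>
      cmp C k l u v \<in> cells C (max k l)"
    and bd_idn: "k < n \<Longrightarrow> u \<in> cells C k \<Longrightarrow> bd C e k (idn C k u) = u"
    and bd_cmp_less: "Suc l \<le> n \<Longrightarrow> k < Suc l \<Longrightarrow> composable C k (Suc l) u v \<Longrightarrow>
      bd C e l (cmp C k (Suc l) u v) = cmp C k l u (bd C e l v)"
    and bd_cmp_greater: "Suc k \<le> n \<Longrightarrow> l < Suc k \<Longrightarrow> composable C (Suc k) l u v \<Longrightarrow>
      bd C e k (cmp C (Suc k) l u v) = cmp C k l (bd C e k u) v"
    and bd_cmp_Minus: "Suc k \<le> n \<Longrightarrow> composable C (Suc k) (Suc k) u v \<Longrightarrow>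
      bd C Minus k (cmp C (Suc k) (Suc k) u v) = bd C Minus k u"
    and bd_cmp_Plus: "Suc k \<le> n \<Longrightarrow> composable C (Suc k) (Suc k) u v \<Longrightarrow>
      bd C Plus k (cmp C (Suc k) (Suc k) u v) = bd C Plus k v"
    and idn_cmp_le: "l \<le> n \<Longrightarrow> Suc k \<le> l \<Longrightarrow> u \<in> cells C k \<Longrightarrow>
      composable C (Suc k) l (idn C k u) v \<Longrightarrow> cmp C (Suc k) l (idn C k u) v = v"
    and idn_cmp_gt: "Suc k \<le> n \<Longrightarrow> Suc k > l \<Longrightarrow> u \<in> cells C k \<Longrightarrow>
      composable C (Suc k) l (idn C k u) v \<Longrightarrow>
      cmp C (Suc k) l (idn C k u) v = idn C k (cmp C k l u v)"
    and cmp_idn_le: "l \<le> n \<Longrightarrow> Suc k \<le> l \<Longrightarrow> u \<in> cells C k \<Longrightarrow>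
      composable C l (Suc k) v (idn C k u) \<Longrightarrow> cmp C l (Suc k) v (idn C k u) = v"
    and cmp_idn_gt: "Suc k \<le> n \<Longrightarrow> Suc k > l \<Longrightarrow> u \<in> cells C k \<Longrightarrow>
      composable C l (Suc k) v (idn C k u) \<Longrightarrow>
      cmp C l (Suc k) v (idn C k u) = idn C k (cmp C l k v u)"
    and cmp_assoc: "k \<le> n \<Longrightarrow> l \<le> n \<Longrightarrow> m \<le> n \<Longrightarrow>
      min k l = Suc i \<Longrightarrow> min (max k l) m = Suc i \<Longrightarrow>
      min l m = Suc i \<Longrightarrow> min k (max l m) = Suc i \<Longrightarrow>
      composable C k l u v \<Longrightarrow> composable C (max k l) m (cmp C k l u v) w \<Longrightarrow>
      composable C l m v w \<Longrightarrow> composable C k (max l m) u (cmp C l m v w) \<Longrightarrow>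
      cmp C (max k l) m (cmp C k l u v) w = cmp C k (max l m) u (cmp C l m v w)"
    and cmp_distrib_left: "k \<le> n \<Longrightarrow> l \<le> n \<Longrightarrow> i < j \<Longrightarrow> min k l = Suc j \<Longrightarrow>
      composable C k l v v' \<Longrightarrow> composable C (Suc i) k u v \<Longrightarrow>
      cmp C (Suc i) (max k l) u (cmp C k l v v') =
      cmp C k l (cmp C (Suc i) k u v) (cmp C (Suc i) l u v')"
    and cmp_distrib_right: "k \<le> n \<Longrightarrow> l \<le> n \<Longrightarrow> i < j \<Longrightarrow> min k l = Suc j \<Longrightarrow>
      composable C k l v v' \<Longrightarrow> composable C k (Suc i) v u \<Longrightarrow>
      cmp C (max k l) (Suc i) (cmp C k l v v') u =
      cmp C k l (cmp C k (Suc i) v u) (cmp C l (Suc i) v' u)"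

definition globular_map ::
    "nat \<Rightarrow> 'a precat \<Rightarrow> 'b precat \<Rightarrow> (nat \<Rightarrow> 'a \<Rightarrow> 'b) \<Rightarrow> bool" where
  "globular_map n C D f \<longleftrightarrow>
     (\<forall>k\<le>n. \<forall>u\<in>cells C k. f k u \<in> cells D k) \<and>
     (\<forall>k<n. \<forall>u\<in>cells C (Suc k). \<forall>e. f k (bd C e k u) = bd D e k (f (Suc k) u))"

definition prefunctor ::
    "nat \<Rightarrow> 'a precat \<Rightarrow> 'b precat \<Rightarrow> (nat \<Rightarrow> 'a \<Rightarrow> 'b) \<Rightarrow> bool" where
  "prefunctor n C D f \<longleftrightarrow>
     globular_map n C D f \<and>
     (\<forall>k<n. \<forall>u\<in>cells C k. f (Suc k) (idn C k u) = idn D k (f k u)) \<and>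
     (\<forall>k\<le>n. \<forall>l\<le>n. \<forall>u v. composable C k l u v \<longrightarrow>
        f (max k l) (cmp C k l u v) = cmp D k l (f k u) (f l v))"

section \<open>The free precategory on a precategory with top-dimensional generators\<close>

text \<open>
  Formal \<open>(n+1)\<close>-cells. In \<open>LWhisk k a t\<close> (formally \<open>a *\<^bsub>k-1\<^esub> t\<close>) and \<open>RWhisk k t a\<close> (formally
  \<open>t *\<^bsub>k-1\<^esub> a\<close>) the cell \<open>a\<close> has dimension \<open>k \<le> n\<close>; \<open>Comp s t\<close> stands for \<open>s *\<^sub>n t\<close>.
\<close>

datatype 'a pterm =
    Gen 'a
  | Ident 'a
  | LWhisk nat 'a "'a pterm"
  | RWhisk nat "'a pterm" 'a
  | Comp "'a pterm" "'a pterm"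

primrec tbd :: "nat \<Rightarrow> 'a precat \<Rightarrow> sgn \<Rightarrow> 'a pterm \<Rightarrow> 'a" where
  "tbd n C e (Gen x) = bd C e n x"
| "tbd n C e (Ident a) = a"
| "tbd n C e (LWhisk k a t) = cmp C k n a (tbd n C e t)"
| "tbd n C e (RWhisk k t a) = cmp C n k (tbd n C e t) a"
| "tbd n C e (Comp s t) = (case e of Minus \<Rightarrow> tbd n C e s | Plus \<Rightarrow> tbd n C e t)"

text \<open>
  As \<open>k \<le> n\<close>, composability of \<open>a\<close> with the source of \<open>t\<close> says that the
  \<open>(k-1)\<close>-target of \<open>a\<close> is the \<open>(k-1)\<close>-source of \<open>t\<close>, i.e. that \<open>a\<close> and \<open>t\<close> are \<open>(k-1)\<close>-composable.
\<close>

primrec wf_term :: "nat \<Rightarrow> 'a precat \<Rightarrow> 'a pterm \<Rightarrow> bool" where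
  "wf_term n C (Gen x) \<longleftrightarrow> x \<in> cells C (Suc n)"
| "wf_term n C (Ident a) \<longleftrightarrow> a \<in> cells C n"
| "wf_term n C (LWhisk k a t) \<longleftrightarrow> k \<le> n \<and> wf_term n C t \<and> composable C k n a (tbd n C Minus t)"
| "wf_term n C (RWhisk k t a) \<longleftrightarrow> k \<le> n \<and> wf_term n C t \<and> composable C n k (tbd n C Plus t) a"
| "wf_term n C (Comp s t) \<longleftrightarrow> wf_term n C s \<and> wf_term n C t \<and> tbd n C Plus s = tbd n C Minus t"

text \<open>The instances of the precategory axioms that equate formal \<open>(n+1)\<close>-cells.\<close>

inductive term_ax :: "nat \<Rightarrow> 'a precat \<Rightarrow> 'a pterm \<Rightarrow> 'a pterm \<Rightarrow> bool" for n C where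
  comp_ident_left: "term_ax n C (Comp (Ident a) t) t"
| comp_ident_right: "term_ax n C (Comp t (Ident a)) t"
| lwhisk_idn: "j < n \<Longrightarrow> a \<in> cells C j \<Longrightarrow> term_ax n C (LWhisk (Suc j) (idn C j a) t) t"
| rwhisk_idn: "j < n \<Longrightarrow> a \<in> cells C j \<Longrightarrow> term_ax n C (RWhisk (Suc j) t (idn C j a)) t"
| lwhisk_ident: "term_ax n C (LWhisk k b (Ident a)) (Ident (cmp C k n b a))"
| rwhisk_ident: "term_ax n C (RWhisk k (Ident a) b) (Ident (cmp C n k a b))"
| comp_assoc: "term_ax n C (Comp (Comp r s) t) (Comp r (Comp s t))"
| lwhisk_cmp: "composable C k k a b \<Longrightarrow>
    term_ax n C (LWhisk k (cmp C k k a b) t) (LWhisk k a (LWhisk k b t))"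
| whisk_assoc: "term_ax n C (RWhisk k (LWhisk k a t) b) (LWhisk k a (RWhisk k t b))"
| rwhisk_cmp: "composable C k k a b \<Longrightarrow>
    term_ax n C (RWhisk k (RWhisk k t a) b) (RWhisk k t (cmp C k k a b))"
| lwhisk_comp: "term_ax n C (LWhisk k a (Comp s t)) (Comp (LWhisk k a s) (LWhisk k a t))"
| rwhisk_comp: "term_ax n C (RWhisk k (Comp s t) a) (Comp (RWhisk k s a) (RWhisk k t a))"
| lwhisk_lwhisk: "k < l \<Longrightarrow> composable C k l a b \<Longrightarrow>
    term_ax n C (LWhisk k a (LWhisk l b t)) (LWhisk l (cmp C k l a b) (LWhisk k a t))"
| lwhisk_rwhisk: "k < l \<Longrightarrow> composable C k l a b \<Longrightarrow>
    term_ax n C (LWhisk k a (RWhisk l t b)) (RWhisk l (LWhisk k a t) (cmp C k l a b))"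
| rwhisk_lwhisk: "k < l \<Longrightarrow> composable C l k b a \<Longrightarrow>
    term_ax n C (RWhisk k (LWhisk l b t) a) (LWhisk l (cmp C l k b a) (RWhisk k t a))"
| rwhisk_rwhisk: "k < l \<Longrightarrow> composable C l k b a \<Longrightarrow>
    term_ax n C (RWhisk k (RWhisk l t b) a) (RWhisk l (RWhisk k t a) (cmp C l k b a))"

inductive term_eq :: "nat \<Rightarrow> 'a precat \<Rightarrow> 'a pterm \<Rightarrow> 'a pterm \<Rightarrow> bool" for n C where
  ax: "term_ax n C s t \<Longrightarrow> wf_term n C s \<Longrightarrow> wf_term n C t \<Longrightarrow> term_eq n C s t"
| refl: "wf_term n C t \<Longrightarrow> term_eq n C t t"
| sym: "term_eq n C s t \<Longrightarrow> term_eq n C t s"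
| trans: "term_eq n C r s \<Longrightarrow> term_eq n C s t \<Longrightarrow> term_eq n C r t"
| lwhisk: "term_eq n C s t \<Longrightarrow> wf_term n C (LWhisk k a s) \<Longrightarrow> wf_term n C (LWhisk k a t) \<Longrightarrow>
    term_eq n C (LWhisk k a s) (LWhisk k a t)"
| rwhisk: "term_eq n C s t \<Longrightarrow> wf_term n C (RWhisk k s a) \<Longrightarrow> wf_term n C (RWhisk k t a) \<Longrightarrow>
    term_eq n C (RWhisk k s a) (RWhisk k t a)"
| comp: "term_eq n C s s' \<Longrightarrow> term_eq n C t t' \<Longrightarrow>
    wf_term n C (Comp s t) \<Longrightarrow> wf_term n C (Comp s' t') \<Longrightarrow>
    term_eq n C (Comp s t) (Comp s' t')"

definition term_class :: "nat \<Rightarrow> 'a precat \<Rightarrow> 'a pterm \<Rightarrow> 'a pterm set" where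
  "term_class n C t = {s. term_eq n C t s}"

definition term_rep :: "'a pterm set \<Rightarrow> 'a pterm" where
  "term_rep X = (SOME t. t \<in> X)"

datatype 'a fcell = Old 'a | New "'a pterm set"

definition free_precat :: "nat \<Rightarrow> 'a precat \<Rightarrow> 'a fcell precat" where
  "free_precat n C = \<lparr>
     cells = (\<lambda>k. if k \<le> n then Old ` cells C k
                  else if k = Suc n then {New (term_class n C t) | t. wf_term n C t} else {}),
     bd = (\<lambda>e k x. case x of Old a \<Rightarrow> Old (bd C e k a) | New X \<Rightarrow> Old (tbd n C e (term_rep X))),
     idn = (\<lambda>k x. case x of
         Old a \<Rightarrow> if k = n then New (term_class n C (Ident a)) else Old (idn C k a)
       | New X \<Rightarrow> undefined),
     cmp = (\<lambda>k l x y. case x of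
         Old a \<Rightarrow> (case y of Old b \<Rightarrow> Old (cmp C k l a b)
                   | New Y \<Rightarrow> New (term_class n C (LWhisk k a (term_rep Y))))
       | New X \<Rightarrow> (case y of Old b \<Rightarrow> New (term_class n C (RWhisk l (term_rep X) b))
                   | New Y \<Rightarrow> New (term_class n C (Comp (term_rep X) (term_rep Y))))) \<rparr>"

text \<open>The unit of the adjunction, along which cells of \<open>C\<close> are regarded as cells of \<open>free_precat n C\<close>.\<close>

definition free_incl :: "nat \<Rightarrow> 'a precat \<Rightarrow> nat \<Rightarrow> 'a \<Rightarrow> 'a fcell" where
  "free_incl n C k x = (if k \<le> n then Old x else New (term_class n C (Gen x)))"

subsection \<open>The universal property\<close>

lemma bds_refl [simp]: "bds C e k k u = u"
  by (cases k) auto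

lemma bds_Suc [simp]: "i \<le> k \<Longrightarrow> bds C e i (Suc k) u = bds C e i k (bd C e k u)"
  by simp

declare bds.simps(2) [simp del]

context globular_set
begin

lemma bds_cell: "i \<le> k \<Longrightarrow> k \<le> n \<Longrightarrow> u \<in> cells C k \<Longrightarrow> bds C e i k u \<in> cells C i"
proof (induction k arbitrary: u)
  case (Suc k)
  show ?case
  proof (cases "i \<le> k")
    case True
    then show ?thesis using Suc bd_cell[of k u e] by simp
  next
    case False
    then have "i = Suc k" using Suc.prems by simp
    then show ?thesis using Suc.prems by simp
  qed
qed simp

lemma bds_eqI:
  assumes "i < k" "\<And>m. k = Suc m \<Longrightarrow> bd C e m x = bd C e m y"
  shows "bds C e i k x = bds C e i k y"
proof -
  obtain m where "k = Suc m" using assms(1) by (cases k) auto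
  then show ?thesis using assms by simp
qed

end

context globular_set
begin

lemma bds_bds:
  "i < j \<Longrightarrow> j \<le> k \<Longrightarrow> k \<le> n \<Longrightarrow> u \<in> cells C k \<Longrightarrow>
   bds C e i j (bds C e' j k u) = bds C e i k u"
proof (induction k arbitrary: u)
  case (Suc m)
  show ?case
  proof (cases "j = Suc m")
    case False
    then have j: "j \<le> m" using Suc.prems by simp
    have "bds C e i m (bd C e' m u) = bds C e i m (bd C e m u)"
      using Suc.prems j globular by (intro bds_eqI) (cases e; cases e'; auto)+
    moreover have "bd C e' m u \<in> cells C m" using Suc.prems bd_cell by simp
    ultimately show ?thesis using Suc j by simp
  qed simp
qed simp

lemma bds_last: "j < k \<Longrightarrow> bds C e j k u = bd C e j (bds C e (Suc j) k u)"
proof (induction k arbitrary: u)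
  case (Suc m)
  then show ?case by (cases "j = m") auto
qed simp

lemma composable_left_iff:
  assumes "i < k"
  shows "composable C k (Suc i) v u \<longleftrightarrow>
    v \<in> cells C k \<and> u \<in> cells C (Suc i) \<and> bds C Plus i k v = bds C Minus i (Suc i) u"
proof -
  have "min k (Suc i) = Suc i" using assms by simp
  then show ?thesis using assms by (simp add: composable_def)
qed

lemma composable_bds_right:
  assumes "composable C (Suc i) k u v" "i < j" "j \<le> k" "k \<le> n"
  shows "composable C (Suc i) j u (bds C e j k v)"
  using assms bds_cell[of j k v e] bds_bds[of i j k v Minus e]
  by (simp add: composable_def min_def)

lemma composable_bds_left:
  assumes "composable C k (Suc i) v u" "i < j" "j \<le> k" "k \<le> n"
  shows "composable C j (Suc i) (bds C e j k v) u"
  using assms bds_cell[of j k v e] bds_bds[of i j k v Plus e]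
  by (simp add: composable_left_iff)

lemma composable_bds_eq:
  assumes "composable C k l v w" "min k l = Suc j" "i < j" "k \<le> n" "l \<le> n"
  shows "bds C e i k v = bds C e i l w"
proof -
  have "bds C e i j (bds C Plus j k v) = bds C e i k v"
    by (rule bds_bds) (use assms in \<open>auto simp: composable_def\<close>)
  moreover have "bds C e i j (bds C Minus j l w) = bds C e i l w"
    by (rule bds_bds) (use assms in \<open>auto simp: composable_def\<close>)
  ultimately show ?thesis using assms by (simp add: composable_def)
qed

lemma composable_cong_right:
  assumes "composable C (Suc i) k u v" "w \<in> cells C l" "i < k" "i < l"
    "bds C Minus i k v = bds C Minus i l w"
  shows "composable C (Suc i) l u w"
  using assms by (simp add: composable_def min_def)

lemma composable_cong_left:
  assumes "composable C k (Suc i) v u" "w \<in> cells C l" "i < k" "i < l"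
    "bds C Plus i k v = bds C Plus i l w"
  shows "composable C l (Suc i) w u"
  using assms by (simp add: composable_left_iff)

end

context precategory
begin

lemma bds_cmp_left:
  "composable C (Suc i) k u v \<Longrightarrow> i < j \<Longrightarrow> j \<le> k \<Longrightarrow> k \<le> n \<Longrightarrow>
   bds C e j k (cmp C (Suc i) k u v) = cmp C (Suc i) j u (bds C e j k v)"
proof (induction k arbitrary: v)
  case (Suc m)
  show ?case
  proof (cases "j = Suc m")
    case False
    then show ?thesis using Suc composable_bds_right[of i "Suc m" u v m e]
      by (simp add: bd_cmp_less)
  qed simp
qed simp

lemma bds_cmp_right:
  "composable C k (Suc i) v u \<Longrightarrow> i < j \<Longrightarrow> j \<le> k \<Longrightarrow> k \<le> n \<Longrightarrow>
   bds C e j k (cmp C k (Suc i) v u) = cmp C j (Suc i) (bds C e j k v) u"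
proof (induction k arbitrary: v)
  case (Suc m)
  show ?case
  proof (cases "j = Suc m")
    case False
    then show ?thesis using Suc composable_bds_left[of "Suc m" i v u m e]
      by (simp add: bd_cmp_greater)
  qed simp
qed simp

lemma bds_cmp_ends:
  assumes "composable C k l v w" "min k l = Suc j" "k \<le> n" "l \<le> n"
  shows "bds C Minus j (max k l) (cmp C k l v w) = bds C Minus j k v"
    and "bds C Plus j (max k l) (cmp C k l v w) = bds C Plus j l w"
proof -
  consider "k = Suc j" "Suc j \<le> l" | "l = Suc j" "Suc j < k"
    using assms(2) by (auto simp: min_def split: if_splits)
  then have "bds C Minus j (max k l) (cmp C k l v w) = bds C Minus j k v \<and>
    bds C Plus j (max k l) (cmp C k l v w) = bds C Plus j l w"
  proof cases
    case 1
    have "bds C e j l (cmp C k l v w) = bd C e j (cmp C k k v (bds C e k l w))" for e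
      using 1 assms bds_last[of j l e] bds_cmp_left[of j l v w k e] by simp
    moreover have "composable C k k v (bds C e k l w)" for e
      using 1 assms composable_bds_right[of j l v w k e] by simp
    ultimately show ?thesis using 1 assms bds_last[of j l Plus w]
      by (simp add: bd_cmp_Minus bd_cmp_Plus max_def)
  next
    case 2
    have "bds C e j k (cmp C k l v w) = bd C e j (cmp C l l (bds C e l k v) w)" for e
      using 2 assms bds_last[of j k e] bds_cmp_right[of k j v w l e] by simp
    moreover have "composable C l l (bds C e l k v) w" for e
      using 2 assms composable_bds_left[of k j v w l e] by simp
    ultimately show ?thesis using 2 assms bds_last[of j k Minus v]
      by (simp add: bd_cmp_Minus bd_cmp_Plus max_def)
  qed
  then show "bds C Minus j (max k l) (cmp C k l v w) = bds C Minus j k v"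
    "bds C Plus j (max k l) (cmp C k l v w) = bds C Plus j l w" by auto
qed

lemma bds_cmp_lower:
  assumes "composable C k l v w" "min k l = Suc j" "i < j" "k \<le> n" "l \<le> n"
  shows "bds C e i (max k l) (cmp C k l v w) = bds C e i k v"
proof -
  have "bds C e i j (bds C Minus j (max k l) (cmp C k l v w)) = bds C e i (max k l) (cmp C k l v w)"
    by (rule bds_bds) (use assms in \<open>auto intro: cmp_cell\<close>)
  moreover have "bds C e i j (bds C Minus j k v) = bds C e i k v"
    by (rule bds_bds) (use assms in \<open>auto simp: composable_def\<close>)
  ultimately show ?thesis using bds_cmp_ends[OF assms(1,2,4,5)] by simp
qed

lemma composable_distrib_left:
  assumes vw: "composable C k l v w" and ij: "min k l = Suc j" "i < j" "k \<le> n" "l \<le> n"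
    and uv: "composable C (Suc i) k u v"
  shows "composable C (Suc i) l u w"
    and "composable C (Suc i) (max k l) u (cmp C k l v w)"
    and "composable C k l (cmp C (Suc i) k u v) (cmp C (Suc i) l u w)"
proof -
  show uw: "composable C (Suc i) l u w"
    using composable_bds_eq[OF vw ij] ij vw
    by (intro composable_cong_right[OF uv]) (auto simp: composable_def)
  show "composable C (Suc i) (max k l) u (cmp C k l v w)"
    using bds_cmp_lower[OF vw ij] ij vw
    by (intro composable_cong_right[OF uv]) (auto intro: cmp_cell)
  have le: "max (Suc i) k = k" "max (Suc i) l = l" "max k (Suc i) = k" "max l (Suc i) = l"
    "Suc i \<le> n"
    using ij by auto
  have "bds C Plus j k (cmp C (Suc i) k u v) = bds C Minus j l (cmp C (Suc i) l u w)"
    using bds_cmp_left[OF uv, of j Plus] bds_cmp_left[OF uw, of j Minus] ij vw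
    by (simp add: composable_def)
  moreover have "cmp C (Suc i) k u v \<in> cells C k" "cmp C (Suc i) l u w \<in> cells C l"
    using cmp_cell[OF _ _ uv] cmp_cell[OF _ _ uw] ij le by simp_all
  ultimately show "composable C k l (cmp C (Suc i) k u v) (cmp C (Suc i) l u w)"
    using ij by (auto simp: composable_def)
qed

lemma composable_distrib_right:
  assumes vw: "composable C k l v w" and ij: "min k l = Suc j" "i < j" "k \<le> n" "l \<le> n"
    and wu: "composable C l (Suc i) w u"
  shows "composable C k (Suc i) v u"
    and "composable C (max k l) (Suc i) (cmp C k l v w) u"
    and "composable C k l (cmp C k (Suc i) v u) (cmp C l (Suc i) w u)"
proof -
  show vu: "composable C k (Suc i) v u"
    using composable_bds_eq[OF vw ij] ij vw
    by (intro composable_cong_left[OF wu]) (auto simp: composable_def)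
  show "composable C (max k l) (Suc i) (cmp C k l v w) u"
    using bds_cmp_lower[OF vw ij] ij vw
    by (intro composable_cong_left[OF vu]) (auto intro: cmp_cell)
  have le: "max (Suc i) k = k" "max (Suc i) l = l" "max k (Suc i) = k" "max l (Suc i) = l"
    "Suc i \<le> n"
    using ij by auto
  have "bds C Plus j k (cmp C k (Suc i) v u) = bds C Minus j l (cmp C l (Suc i) w u)"
    using bds_cmp_right[OF vu, of j Plus] bds_cmp_right[OF wu, of j Minus] ij vw
    by (simp add: composable_def)
  moreover have "cmp C k (Suc i) v u \<in> cells C k" "cmp C l (Suc i) w u \<in> cells C l"
    using cmp_cell[OF _ _ vu] cmp_cell[OF _ _ wu] ij le by simp_all
  ultimately show "composable C k l (cmp C k (Suc i) v u) (cmp C l (Suc i) w u)"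
    using ij by (auto simp: composable_def)
qed

lemma composable_distrib_right':
  assumes vw: "composable C k l v w" and ij: "min k l = Suc j" "i < j" "k \<le> n" "l \<le> n"
    and vu: "composable C k (Suc i) v u"
  shows "composable C l (Suc i) w u"
  using composable_bds_eq[OF vw ij] ij vw
  by (intro composable_cong_left[OF vu]) (auto simp: composable_def)

end

lemma globular_map_bds:
  assumes "globular_map n C D f" "globular_set n C"
  shows "i \<le> k \<Longrightarrow> k \<le> n \<Longrightarrow> u \<in> cells C k \<Longrightarrow> bds D e i k (f k u) = f i (bds C e i k u)"
proof (induction k arbitrary: u)
  case (Suc k)
  show ?case
  proof (cases "i \<le> k")
    case True
    have "bd C e k u \<in> cells C k"
      using assms(2) Suc.prems by (auto intro: globular_set.bd_cell)
    moreover have "bd D e k (f (Suc k) u) = f k (bd C e k u)"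
      using assms(1) Suc.prems unfolding globular_map_def by simp
    ultimately show ?thesis using Suc True by simp
  next
    case False
    then have "i = Suc k" using Suc.prems by simp
    then show ?thesis by simp
  qed
qed simp

lemma globular_map_composable:
  assumes "globular_map n C D f" "globular_set n C" "composable C k l u v" "k \<le> n" "l \<le> n"
  shows "composable D k l (f k u) (f l v)"
proof -
  have u: "u \<in> cells C k" and v: "v \<in> cells C l" using assms(3) by (auto simp: composable_def)
  have "bds D Plus (min k l - 1) k (f k u) = f (min k l - 1) (bds C Plus (min k l - 1) k u)"
    by (rule globular_map_bds[OF assms(1,2) _ assms(4) u]) auto
  moreover have "bds D Minus (min k l - 1) l (f l v) = f (min k l - 1) (bds C Minus (min k l - 1) l v)"
    by (rule globular_map_bds[OF assms(1,2) _ assms(5) v]) auto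
  ultimately show ?thesis
    using assms u v unfolding composable_def globular_map_def by auto
qed

locale precategory_plus = precategory n C + top: globular_set "Suc n" C
  for n :: nat and C :: "'a precat"
begin

abbreviation "wft \<equiv> wf_term n C"
abbreviation "teq \<equiv> term_eq n C"
abbreviation "src \<equiv> tbd n C Minus"
abbreviation "tgt \<equiv> tbd n C Plus"
abbreviation "cl \<equiv> term_class n C"
abbreviation "F \<equiv> free_precat n C"

lemma lwhisk_aux:
  assumes "composable C k n a x" "k \<le> n" "y \<in> cells C n"
    "\<And>m. n = Suc m \<Longrightarrow> bd C Minus m x = bd C Minus m y"
  shows "composable C k n a y"
proof -
  have "bds C Minus (min k n - 1) n x = bds C Minus (min k n - 1) n y"
    using assms by (intro bds_eqI) (auto simp: composable_def)
  then show ?thesis using assms by (simp add: composable_def)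
qed

lemma rwhisk_aux:
  assumes "composable C n k x a" "k \<le> n" "y \<in> cells C n"
    "\<And>m. n = Suc m \<Longrightarrow> bd C Plus m x = bd C Plus m y"
  shows "composable C n k y a"
proof -
  have "bds C Plus (min n k - 1) n x = bds C Plus (min n k - 1) n y"
    using assms by (intro bds_eqI) (auto simp: composable_def)
  then show ?thesis using assms by (simp add: composable_def)
qed

lemma tbd_props:
  "wft t \<Longrightarrow> (\<forall>e. tbd n C e t \<in> cells C n) \<and>
     (\<forall>m e. n = Suc m \<longrightarrow> bd C e m (src t) = bd C e m (tgt t))"
proof (induction t)
  case (Gen x)
  then show ?case using top.bd_cell[of n x] top.globular[of _ x] by auto
next
  case (LWhisk k a t)
  then have IH: "\<And>e. tbd n C e t \<in> cells C n"
    "\<And>m e. n = Suc m \<Longrightarrow> bd C e m (src t) = bd C e m (tgt t)" and k: "k \<le> n" by auto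
  have cp: "composable C k n a (tbd n C e t)" for e
    using LWhisk.prems IH by (cases e) (auto intro: lwhisk_aux)
  have "cmp C k n a (tbd n C e t) \<in> cells C n" for e
    using cmp_cell[OF k _ cp[of e]] k by (simp add: max_def)
  moreover have "bd C e m (cmp C k n a (src t)) = bd C e m (cmp C k n a (tgt t))"
    if "n = Suc m" for m e
  proof (cases "k = n")
    case True
    then show ?thesis
      using that cp[of Minus] cp[of Plus] IH
      by (cases e) (auto simp: bd_cmp_Minus bd_cmp_Plus)
  next
    case False
    then show ?thesis using that cp[of Minus] cp[of Plus] IH k
      by (auto simp: bd_cmp_less)
  qed
  ultimately show ?case by auto
next
  case (RWhisk k t a)
  then have IH: "\<And>e. tbd n C e t \<in> cells C n"
    "\<And>m e. n = Suc m \<Longrightarrow> bd C e m (src t) = bd C e m (tgt t)" and k: "k \<le> n" by auto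
  have cp: "composable C n k (tbd n C e t) a" for e
    using RWhisk.prems IH by (cases e) (auto intro: rwhisk_aux)
  have "cmp C n k (tbd n C e t) a \<in> cells C n" for e
    using cmp_cell[OF _ k cp[of e]] k by (simp add: max_def)
  moreover have "bd C e m (cmp C n k (src t) a) = bd C e m (cmp C n k (tgt t) a)"
    if "n = Suc m" for m e
  proof (cases "k = n")
    case True
    then show ?thesis
      using that cp[of Minus] cp[of Plus] IH
      by (cases e) (auto simp: bd_cmp_Minus bd_cmp_Plus)
  next
    case False
    then show ?thesis using that cp[of Minus] cp[of Plus] IH k
      by (auto simp: bd_cmp_greater)
  qed
  ultimately show ?case by auto
next
  case (Comp s t)
  then show ?case by (auto split: sgn.splits)
qed auto

lemma tbd_cell: "wft t \<Longrightarrow> tbd n C e t \<in> cells C n"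
  using tbd_props by blast

lemma tbd_globular: "wft t \<Longrightarrow> n = Suc m \<Longrightarrow> bd C e m (tbd n C e' t) = bd C e m (tbd n C e'' t)"
  using tbd_props[of t] by (cases e'; cases e'') auto

lemma bds_tbd: "wft t \<Longrightarrow> i < n \<Longrightarrow> bds C e i n (tbd n C e' t) = bds C e i n (tbd n C e'' t)"
  using tbd_globular by (intro bds_eqI) auto

lemma composable_tbd_left_iff:
  "wft t \<Longrightarrow> k \<le> n \<Longrightarrow> composable C k n a (tbd n C e t) \<longleftrightarrow> composable C k n a (tbd n C e' t)"
  using tbd_cell tbd_globular by (blast intro: lwhisk_aux)

lemma composable_tbd_right_iff:
  "wft t \<Longrightarrow> k \<le> n \<Longrightarrow> composable C n k (tbd n C e t) a \<longleftrightarrow> composable C n k (tbd n C e' t) a"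
  using tbd_cell tbd_globular by (blast intro: rwhisk_aux)

lemma wf_LWhisk: "wft (LWhisk k a t) \<longleftrightarrow> k \<le> n \<and> wft t \<and> composable C k n a (tbd n C e t)"
  using composable_tbd_left_iff[of t k a e Minus] by auto

lemma wf_RWhisk: "wft (RWhisk k t a) \<longleftrightarrow> k \<le> n \<and> wft t \<and> composable C n k (tbd n C e t) a"
  using composable_tbd_right_iff[of t k e a Plus] by auto

lemma composableD:
  "composable C k l u v \<Longrightarrow> 0 < k \<and> 0 < l \<and> u \<in> cells C k \<and> v \<in> cells C l"
  by (simp add: composable_def)

lemma term_ax_tbd:
  assumes "term_ax n C s t" "wft s" "wft t"
  shows "tbd n C e s = tbd n C e t"
  using assms
proof (cases rule: term_ax.cases)
  case (comp_ident_left a)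
  then show ?thesis using assms by (auto split: sgn.splits)
next
  case (comp_ident_right a)
  then show ?thesis using assms by (auto split: sgn.splits)
next
  case (lwhisk_idn j a)
  then show ?thesis using assms idn_cmp_le[of n j a] by (simp only: wf_LWhisk[of _ _ _ e]) simp
next
  case (rwhisk_idn j a)
  then show ?thesis using assms cmp_idn_le[of n j a] by (simp only: wf_RWhisk[of _ _ _ e]) simp
next
  case (comp_assoc r s t)
  then show ?thesis by (auto split: sgn.splits)
next
  case (lwhisk_cmp k a b t)
  then have "composable C k n (cmp C k k a b) (tbd n C e t)"
    "composable C k n b (tbd n C e t)" "composable C k n a (cmp C k n b (tbd n C e t))" "k \<le> n"
    using assms
    by (auto simp: wf_LWhisk[of _ _ _ e] wf_RWhisk[of _ _ _ e] simp del: wf_term.simps(3,4))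
  moreover have "0 < k" using lwhisk_cmp composableD by blast
  ultimately show ?thesis
    using cmp_assoc[of k k n "k - 1" a b "tbd n C e t"] lwhisk_cmp
    by (simp add: max_def min_def split: if_splits)
next
  case (whisk_assoc k a t b)
  then have "composable C k n a (tbd n C e t)" "composable C n k (tbd n C e t) b"
    "composable C k n a (cmp C n k (tbd n C e t) b)"
    "composable C n k (cmp C k n a (tbd n C e t)) b" "k \<le> n"
    using assms
    by (auto simp: wf_LWhisk[of _ _ _ e] wf_RWhisk[of _ _ _ e] simp del: wf_term.simps(3,4))
  moreover have "0 < k" using calculation composableD by blast
  ultimately show ?thesis
    using cmp_assoc[of k n k "k - 1" a "tbd n C e t" b] whisk_assoc
    by (simp add: max_def min_def split: if_splits)
next
  case (rwhisk_cmp k a b t)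
  then have "composable C n k (tbd n C e t) (cmp C k k a b)"
    "composable C n k (tbd n C e t) a" "composable C n k (cmp C n k (tbd n C e t) a) b" "k \<le> n"
    using assms
    by (auto simp: wf_LWhisk[of _ _ _ e] wf_RWhisk[of _ _ _ e] simp del: wf_term.simps(3,4))
  moreover have "0 < k" using rwhisk_cmp composableD by blast
  ultimately show ?thesis
    using cmp_assoc[of n k k "k - 1" "tbd n C e t" a b] rwhisk_cmp
    by (simp add: max_def min_def split: if_splits)
next
  case (lwhisk_comp k a s t)
  then show ?thesis by (auto split: sgn.splits)
next
  case (rwhisk_comp k s t a)
  then show ?thesis by (auto split: sgn.splits)
next
  case (lwhisk_lwhisk k l a b t)
  then have "composable C l n b (tbd n C e t)" "k \<le> n" "l \<le> n" "0 < k" "0 < l"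
    using assms composableD[of k l a b]
    by (auto simp: wf_LWhisk[of _ _ _ e] wf_RWhisk[of _ _ _ e] simp del: wf_term.simps(3,4))
  then show ?thesis
    using cmp_distrib_left[of l n "k - 1" "l - 1" b "tbd n C e t" a] lwhisk_lwhisk
    by (simp add: max_def min_def split: if_splits)
next
  case (lwhisk_rwhisk k l a b t)
  then have "composable C n l (tbd n C e t) b" "composable C k n a (tbd n C e t)"
    "k \<le> n" "l \<le> n" "0 < k" "0 < l"
    using assms composableD[of k l a b]
    by (auto simp: wf_LWhisk[of _ _ _ e] wf_RWhisk[of _ _ _ e] simp del: wf_term.simps(3,4))
  then show ?thesis
    using cmp_distrib_left[of n l "k - 1" "l - 1" "tbd n C e t" b a] lwhisk_rwhisk
    by (simp add: max_def min_def split: if_splits)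
next
  case (rwhisk_lwhisk k l b a t)
  then have "composable C l n b (tbd n C e t)" "composable C n k (tbd n C e t) a"
    "k \<le> n" "l \<le> n" "0 < k" "0 < l"
    using assms composableD[of l k b a]
    by (auto simp: wf_LWhisk[of _ _ _ e] wf_RWhisk[of _ _ _ e] simp del: wf_term.simps(3,4))
  then show ?thesis
    using cmp_distrib_right[of l n "k - 1" "l - 1" b "tbd n C e t" a] rwhisk_lwhisk
    by (simp add: max_def min_def split: if_splits)
next
  case (rwhisk_rwhisk k l b a t)
  then have "composable C n l (tbd n C e t) b" "composable C n k (tbd n C e t) a"
    "k \<le> n" "l \<le> n" "0 < k" "0 < l"
    using assms composableD[of l k b a]
    by (auto simp: wf_LWhisk[of _ _ _ e] wf_RWhisk[of _ _ _ e] simp del: wf_term.simps(3,4))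
  then show ?thesis
    using cmp_distrib_right[of n l "k - 1" "l - 1" "tbd n C e t" b a] rwhisk_rwhisk
    by (simp add: max_def min_def split: if_splits)
qed (use assms in auto)

lemma term_eq_props:
  "teq s t \<Longrightarrow> wft s \<and> wft t \<and> (\<forall>e. tbd n C e s = tbd n C e t)"
proof (induction rule: term_eq.induct)
  case (ax s t)
  then show ?case using term_ax_tbd by blast
next
  case (comp s s' t t')
  then show ?case by (auto split: sgn.splits)
qed auto

lemma cl_eq_iff: "wft s \<Longrightarrow> cl s = cl t \<longleftrightarrow> teq s t"
  unfolding term_class_def
  by (blast intro: term_eq.refl term_eq.sym term_eq.trans)

lemma rep_cl: "wft t \<Longrightarrow> teq t (term_rep (cl t))"
  unfolding term_rep_def term_class_def
  by (metis (mono_tags, lifting) mem_Collect_eq someI term_eq.refl)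

lemma Old_cell [simp]: "Old a \<in> cells F k \<longleftrightarrow> k \<le> n \<and> a \<in> cells C k"
  by (auto simp: free_precat_def)

lemma New_cell: "New X \<in> cells F k \<longleftrightarrow> k = Suc n \<and> (\<exists>t. wft t \<and> X = cl t)"
  by (auto simp: free_precat_def)

lemma New_cl_cell [simp]: "wft t \<Longrightarrow> New (cl t) \<in> cells F k \<longleftrightarrow> k = Suc n"
  by (auto simp: New_cell)

lemma F_cell_cases:
  assumes "x \<in> cells F k"
  obtains a where "x = Old a" "k \<le> n" "a \<in> cells C k"
  | t where "x = New (cl t)" "k = Suc n" "wft t"
  using assms by (cases x) (auto simp: New_cell)

lemma F_bd [simp]:
  "bd F e k (Old a) = Old (bd C e k a)"
  "wft t \<Longrightarrow> bd F e k (New (cl t)) = Old (tbd n C e t)"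
  using rep_cl[of t] term_eq_props[of t "term_rep (cl t)"] by (auto simp: free_precat_def)

lemma F_idn [simp]:
  "k < n \<Longrightarrow> idn F k (Old a) = Old (idn C k a)"
  "idn F n (Old a) = New (cl (Ident a))"
  by (auto simp: free_precat_def)

lemma F_cmp [simp]:
  "cmp F k l (Old a) (Old b) = Old (cmp C k l a b)"
  "wft (LWhisk k a t) \<Longrightarrow> cmp F k l (Old a) (New (cl t)) = New (cl (LWhisk k a t))"
  "wft (RWhisk k t a) \<Longrightarrow> cmp F l k (New (cl t)) (Old a) = New (cl (RWhisk k t a))"
  "wft (Comp s t) \<Longrightarrow> cmp F k l (New (cl s)) (New (cl t)) = New (cl (Comp s t))"
proof -
  show "cmp F k l (Old a) (Old b) = Old (cmp C k l a b)" by (simp add: free_precat_def)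
  show "cmp F k l (Old a) (New (cl t)) = New (cl (LWhisk k a t))" if "wft (LWhisk k a t)"
  proof -
    have "teq t (term_rep (cl t))" using that by (auto intro: rep_cl)
    then have "teq (LWhisk k a t) (LWhisk k a (term_rep (cl t)))"
      using that term_eq_props[of t "term_rep (cl t)"] by (intro term_eq.lwhisk) auto
    then have "cl (LWhisk k a (term_rep (cl t))) = cl (LWhisk k a t)"
      using cl_eq_iff[OF that] by metis
    then show ?thesis by (simp add: free_precat_def)
  qed
  show "cmp F l k (New (cl t)) (Old a) = New (cl (RWhisk k t a))" if "wft (RWhisk k t a)"
  proof -
    have "teq t (term_rep (cl t))" using that by (auto intro: rep_cl)
    then have "teq (RWhisk k t a) (RWhisk k (term_rep (cl t)) a)"
      using that term_eq_props[of t "term_rep (cl t)"] by (intro term_eq.rwhisk) auto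
    then have "cl (RWhisk k (term_rep (cl t)) a) = cl (RWhisk k t a)"
      using cl_eq_iff[OF that] by metis
    then show ?thesis by (simp add: free_precat_def)
  qed
  show "cmp F k l (New (cl s)) (New (cl t)) = New (cl (Comp s t))" if "wft (Comp s t)"
  proof -
    have "teq t (term_rep (cl t))" "teq s (term_rep (cl s))" using that by (auto intro: rep_cl)
    then have "teq (Comp s t) (Comp (term_rep (cl s)) (term_rep (cl t)))"
      using that term_eq_props[of t "term_rep (cl t)"] term_eq_props[of s "term_rep (cl s)"]
      by (intro term_eq.comp) auto
    then have "cl (Comp (term_rep (cl s)) (term_rep (cl t))) = cl (Comp s t)"
      using cl_eq_iff[OF that] by metis
    then show ?thesis by (simp add: free_precat_def)
  qed
qed

lemma F_bds_Old [simp]: "bds F e i k (Old a) = Old (bds C e i k a)"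
  by (induction k arbitrary: a) (auto simp: bds.simps)

lemma F_bds_New [simp]:
  "wft t \<Longrightarrow> i \<le> n \<Longrightarrow> bds F e i (Suc n) (New (cl t)) = Old (bds C e i n (tbd n C e t))"
  by simp

lemma F_composable [simp]:
  "k \<le> n \<Longrightarrow> l \<le> n \<Longrightarrow> composable F k l (Old a) (Old b) \<longleftrightarrow> composable C k l a b"
  "wft t \<Longrightarrow> k \<le> n \<Longrightarrow> composable F k (Suc n) (Old a) (New (cl t)) \<longleftrightarrow> wft (LWhisk k a t)"
  "wft t \<Longrightarrow> k \<le> n \<Longrightarrow> composable F (Suc n) k (New (cl t)) (Old a) \<longleftrightarrow> wft (RWhisk k t a)"
  "wft s \<Longrightarrow> wft t \<Longrightarrow> composable F (Suc n) (Suc n) (New (cl s)) (New (cl t)) \<longleftrightarrow> wft (Comp s t)"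
  using tbd_cell[of t] by (auto simp: composable_def min_def)

lemma F_composable_cases:
  assumes "composable F k l x y"
  obtains a b where "x = Old a" "y = Old b" "k \<le> n" "l \<le> n" "composable C k l a b"
  | a t where "x = Old a" "y = New (cl t)" "k \<le> n" "l = Suc n" "wft (LWhisk k a t)"
  | t a where "x = New (cl t)" "y = Old a" "k = Suc n" "l \<le> n" "wft (RWhisk l t a)"
  | s t where "x = New (cl s)" "y = New (cl t)" "k = Suc n" "l = Suc n" "wft (Comp s t)"
proof -
  have x: "x \<in> cells F k" and y: "y \<in> cells F l" using assms by (auto simp: composable_def)
  show thesis
  proof (cases rule: F_cell_cases[OF x])
    case x: (1 a)
    show ?thesis
    proof (cases rule: F_cell_cases[OF y])
      case (1 b)
      then show ?thesis using x assms that(1) by simp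
    next
      case (2 t)
      then show ?thesis using x assms that(2) by (metis F_composable(2))
    qed
  next
    case x: (2 s)
    show ?thesis
    proof (cases rule: F_cell_cases[OF y])
      case (1 b)
      then show ?thesis using x assms that(3) by (metis F_composable(3))
    next
      case (2 t)
      then show ?thesis using x assms that(4) by (metis F_composable(4))
    qed
  qed
qed

lemma New_eqI: "term_ax n C s t \<Longrightarrow> wft s \<Longrightarrow> wft t \<Longrightarrow> New (cl s) = New (cl t)"
  using cl_eq_iff term_eq.ax by blast

lemma precategory_free: "precategory (Suc n) F"
proof
  fix k u e assume k: "k < Suc n" and u: "u \<in> cells F (Suc k)"
  show "bd F e k u \<in> cells F k"
    using u k by (cases rule: F_cell_cases) (auto intro: bd_cell tbd_cell)
next
  fix k u e assume k: "Suc k < Suc n" and u: "u \<in> cells F (Suc (Suc k))"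
  from u k show "bd F e k (bd F Minus (Suc k) u) = bd F e k (bd F Plus (Suc k) u)"
    by (cases rule: F_cell_cases) (auto simp: globular tbd_globular[of _ _ _ Minus Plus])
next
  fix k u assume k: "k < Suc n" and u: "u \<in> cells F k"
  show "idn F k u \<in> cells F (Suc k)"
    using u k by (cases rule: F_cell_cases; cases "k = n") (auto intro: idn_cell)
next
  fix k l u v assume "composable F k l u v"
  then show "cmp F k l u v \<in> cells F (max k l)"
  proof (cases rule: F_composable_cases)
    case (1 a b)
    then show ?thesis using cmp_cell[of k l a b] by simp
  qed (simp_all add: max_def del: wf_term.simps(3-5))
next
  fix k u e assume k: "k < Suc n" and u: "u \<in> cells F k"
  show "bd F e k (idn F k u) = u"
    using u k by (cases rule: F_cell_cases; cases "k = n") (auto simp: bd_idn)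
next
  fix k l u v e assume kl: "k < Suc l" and uv: "composable F k (Suc l) u v"
  from uv kl show "bd F e l (cmp F k (Suc l) u v) = cmp F k l u (bd F e l v)"
    by (cases rule: F_composable_cases) (auto simp: bd_cmp_less)
next
  fix k l u v e assume kl: "l < Suc k" and uv: "composable F (Suc k) l u v"
  from uv kl show "bd F e k (cmp F (Suc k) l u v) = cmp F k l (bd F e k u) v"
    by (cases rule: F_composable_cases) (auto simp: bd_cmp_greater)
next
  fix k u v assume "composable F (Suc k) (Suc k) u v"
  then show "bd F Minus k (cmp F (Suc k) (Suc k) u v) = bd F Minus k u"
    by (cases rule: F_composable_cases) (auto simp: bd_cmp_Minus)
next
  fix k u v assume "composable F (Suc k) (Suc k) u v"
  then show "bd F Plus k (cmp F (Suc k) (Suc k) u v) = bd F Plus k v"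
    by (cases rule: F_composable_cases) (auto simp: bd_cmp_Plus)
next
  fix k l u v
  assume kl: "Suc k \<le> l" and u: "u \<in> cells F k" and uv: "composable F (Suc k) l (idn F k u) v"
  have "l \<le> Suc n" using uv by (cases rule: F_composable_cases) auto
  then obtain a where a: "u = Old a" "k \<le> n" "a \<in> cells C k"
    using u kl by (auto elim!: F_cell_cases)
  show "cmp F (Suc k) l (idn F k u) v = v"
  proof (cases "k = n")
    case True
    then have "l = Suc n" using kl \<open>l \<le> Suc n\<close> by simp
    with uv True a obtain t where "v = New (cl t)" "wft t"
      by (auto simp: composable_def elim!: F_cell_cases)
    with uv True a \<open>l = Suc n\<close> show ?thesis
      by (simp add: New_eqI[OF term_ax.comp_ident_left])
  next
    case False
    then have k: "k < n" using a by simp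
    show ?thesis
    proof (cases rule: F_composable_cases[OF uv])
      case (1 b c)
      then show ?thesis using k a kl by (auto simp: idn_cmp_le)
    next
      case (2 b t)
      then have b: "b = idn C k a" and w: "wft (LWhisk (Suc k) b t)" "wft t" using k a by auto
      have "cl (LWhisk (Suc k) b t) = cl t"
        using w New_eqI[OF term_ax.lwhisk_idn[OF k a(3)], of t] unfolding b by simp
      then show ?thesis using 2 k a by (simp del: wf_term.simps(3))
    qed (use k a in auto)
  qed
next
  fix k l u v
  assume kl: "Suc k \<le> Suc n" "Suc k > l" and u: "u \<in> cells F k"
    and uv: "composable F (Suc k) l (idn F k u) v"
  obtain a where a: "u = Old a" "k \<le> n" "a \<in> cells C k"
    using u kl by (auto elim!: F_cell_cases)
  obtain b where b: "v = Old b" "b \<in> cells C l"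
    using uv kl by (auto simp: composable_def elim!: F_cell_cases)
  show "cmp F (Suc k) l (idn F k u) v = idn F k (cmp F k l u v)"
  proof (cases "k = n")
    case True
    then have "wft (RWhisk l (Ident a) b)"
      using uv kl a b by (metis F_composable(3) F_idn(2) less_Suc_eq_le wf_term.simps(2))
    moreover then have "wft (Ident (cmp C n l a b))"
      using tbd_cell[of "RWhisk l (Ident a) b"] by simp
    ultimately show ?thesis using True a b
      by (simp add: New_eqI[OF term_ax.rwhisk_ident])
  next
    case False
    with uv a b kl show ?thesis by (simp add: idn_cmp_gt)
  qed
next
  fix k l u v
  assume kl: "Suc k \<le> l" and u: "u \<in> cells F k" and uv: "composable F l (Suc k) v (idn F k u)"
  have "l \<le> Suc n" using uv by (cases rule: F_composable_cases) auto
  then obtain a where a: "u = Old a" "k \<le> n" "a \<in> cells C k"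
    using u kl by (auto elim!: F_cell_cases)
  show "cmp F l (Suc k) v (idn F k u) = v"
  proof (cases "k = n")
    case True
    then have "l = Suc n" using kl \<open>l \<le> Suc n\<close> by simp
    with uv True a obtain t where "v = New (cl t)" "wft t"
      by (auto simp: composable_def elim!: F_cell_cases)
    with uv True a \<open>l = Suc n\<close> show ?thesis
      by (simp add: New_eqI[OF term_ax.comp_ident_right])
  next
    case False
    then have k: "k < n" using a by simp
    show ?thesis
    proof (cases rule: F_composable_cases[OF uv])
      case (1 b c)
      then show ?thesis using k a kl by (auto simp: cmp_idn_le)
    next
      case (3 t b)
      then have b: "b = idn C k a" and w: "wft (RWhisk (Suc k) t b)" "wft t" using k a by auto
      have "cl (RWhisk (Suc k) t b) = cl t"
        using w New_eqI[OF term_ax.rwhisk_idn[OF k a(3)], of t] unfolding b by simp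
      then show ?thesis using 3 k a by (simp del: wf_term.simps(4))
    qed (use k a in auto)
  qed
next
  fix k l u v
  assume kl: "Suc k \<le> Suc n" "Suc k > l" and u: "u \<in> cells F k"
    and uv: "composable F l (Suc k) v (idn F k u)"
  obtain a where a: "u = Old a" "k \<le> n" "a \<in> cells C k"
    using u kl by (auto elim!: F_cell_cases)
  obtain b where b: "v = Old b" "b \<in> cells C l"
    using uv kl by (auto simp: composable_def elim!: F_cell_cases)
  show "cmp F l (Suc k) v (idn F k u) = idn F k (cmp F l k v u)"
  proof (cases "k = n")
    case True
    then have "wft (LWhisk l b (Ident a))"
      using uv kl a b by (metis F_composable(2) F_idn(2) less_Suc_eq_le wf_term.simps(2))
    moreover then have "wft (Ident (cmp C l n b a))"
      using tbd_cell[of "LWhisk l b (Ident a)"] by simp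
    ultimately show ?thesis using True a b
      by (simp add: New_eqI[OF term_ax.lwhisk_ident])
  next
    case False
    with uv a b kl show ?thesis by (simp add: cmp_idn_gt)
  qed
next
  fix k l m i u v w
  assume d: "min k l = Suc i" "min (max k l) m = Suc i" "min l m = Suc i" "min k (max l m) = Suc i"
    and uv: "composable F k l u v" and uvw: "composable F (max k l) m (cmp F k l u v) w"
    and vw: "composable F l m v w" and uvw': "composable F k (max l m) u (cmp F l m v w)"
  note del = wf_term.simps(3-5)
  show "cmp F (max k l) m (cmp F k l u v) w = cmp F k (max l m) u (cmp F l m v w)"
  proof (cases rule: F_composable_cases[OF uv])
    case u: (1 a b)
    show ?thesis
    proof (cases rule: F_composable_cases[OF vw])
      case (1 b' c)
      then show ?thesis using u d uv uvw vw uvw' cmp_assoc[of k l m i a b c]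
        by simp
    next
      case (2 b' t)
      then have kl: "l = k" "max k l = k" "max l m = Suc n"
        using u d by (auto simp: min_def max_def split: if_splits)
      have wt: "wft t" using 2 by simp
      have "wft (LWhisk k (cmp C k k a b) t)" "wft (LWhisk k a (LWhisk k b t))"
        using uvw uvw' 2 u kl wt by (simp_all del: del)
      then show ?thesis using 2 u kl uv
        by (simp add: New_eqI[OF term_ax.lwhisk_cmp] del: del)
    qed (use u in auto)
  next
    case u: (2 a t)
    show ?thesis
    proof (cases rule: F_composable_cases[OF vw])
      case (3 t' b)
      then have kl: "m = k" "max k l = Suc n" "max l m = Suc n" and b: "w = Old b"
        using u d by (auto simp: min_def max_def split: if_splits)
      have t: "wft t" using u by simp
      have wt: "wft (RWhisk k t b)" using vw u b kl t by simp
      have "wft (RWhisk k (LWhisk k a t) b)" "wft (LWhisk k a (RWhisk k t b))"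
        using uvw uvw' u kl wt b by (simp_all del: del)
      then show ?thesis using u kl wt b
        by (simp add: New_eqI[OF term_ax.whisk_assoc] del: del)
    next
      case (4 s s')
      then have False using u d by auto
      then show ?thesis ..
    qed (use u in auto)
  next
    case u: (3 t a)
    show ?thesis
    proof (cases rule: F_composable_cases[OF vw])
      case (1 a' b)
      then have kl: "l = m" "max k l = Suc n" "max l m = m" "m \<le> n"
        using u d by (auto simp: min_def max_def split: if_splits)
      have wt: "wft t" using u by simp
      have "wft (RWhisk m (RWhisk m t a) b)" "wft (RWhisk m t (cmp C m m a b))"
        using uvw uvw' 1 u kl wt by (simp_all del: del)
      then show ?thesis using 1 u kl vw
        by (simp add: New_eqI[OF term_ax.rwhisk_cmp] del: del)
    next
      case (2 a' s)
      then have False using u d by auto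
      then show ?thesis ..
    qed (use u in auto)
  next
    case u: (4 s t)
    show ?thesis
    proof (cases rule: F_composable_cases[OF vw])
      case (3 t' b)
      then have False using u d by auto
      then show ?thesis ..
    next
      case (4 t' r)
      have r: "w = New (cl r)" "wft r" "m = Suc n" using 4 by simp_all
      have wt: "wft (Comp t r)" using vw u r by simp
      have "wft (Comp (Comp s t) r)" "wft (Comp s (Comp t r))"
        using wt u by simp_all
      then show ?thesis using u r wt
        by (simp add: New_eqI[OF term_ax.comp_assoc] del: del)
    qed (use u in auto)
  qed
next
  fix k l i j u v w
  assume d: "i < j" "min k l = Suc j" and vw: "composable F k l v w"
    and uv: "composable F (Suc i) k u v"
  let ?i = "Suc i"
  note del = wf_term.simps(3-5)
  have i: "?i \<le> n"
    using vw d by (cases rule: F_composable_cases) auto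
  obtain a where a: "u = Old a" "a \<in> cells C ?i"
    using uv i by (auto simp: composable_def elim!: F_cell_cases)
  show "cmp F ?i (max k l) u (cmp F k l v w) = cmp F k l (cmp F ?i k u v) (cmp F ?i l u w)"
  proof (cases rule: F_composable_cases[OF vw])
    case (1 b c)
    then show ?thesis using uv a i d cmp_distrib_left[of k l i j b c a] by simp
  next
    case (2 b t)
    then have kl: "max k l = Suc n" "?i < k" "l = Suc n" "min k n = Suc j" using d by auto
    have ab: "composable C ?i k a b" using uv a 2 i by simp
    have "composable C k n b (src t)" using 2 by simp
    note c = composable_distrib_left[OF this kl(4) d(1) _ _ ab]
    have w: "wft (LWhisk ?i a t)" "wft (LWhisk ?i a (LWhisk k b t))"
        "wft (LWhisk k (cmp C ?i k a b) (LWhisk ?i a t))"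
      using c 2 i by (simp_all add: max_def)
    show ?thesis using 2 a kl i w ab
      by (simp add: New_eqI[OF term_ax.lwhisk_lwhisk] del: del)
  next
    case (3 t b)
    then have kl: "max k l = Suc n" "?i < l" "k = Suc n" "min n l = Suc j" using d by auto
    have wt: "wft (LWhisk ?i a t)" using uv a 3 i by simp
    then have at: "composable C ?i n a (tgt t)" unfolding wf_LWhisk[of _ _ _ Plus] by simp
    have "composable C n l (tgt t) b" using 3 by simp
    note c = composable_distrib_left[OF this kl(4) d(1) _ _ at]
    have w: "wft (LWhisk ?i a (RWhisk l t b))"
      using c(2) 3 i unfolding wf_LWhisk[of ?i a "RWhisk l t b" Plus] by (simp add: max_def)
    have w': "wft (RWhisk l (LWhisk ?i a t) (cmp C ?i l a b))"
      using c(3) 3 wt by simp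
    have ab: "composable C ?i l a b" using c 3 by simp
    show ?thesis using 3 a kl i w w' wt ab
      by (simp add: New_eqI[OF term_ax.lwhisk_rwhisk] del: del)
  next
    case (4 s t)
    then have ws: "wft (LWhisk ?i a s)" using uv a i by simp
    then have as: "composable C ?i n a (tgt s)" unfolding wf_LWhisk[of _ _ _ Plus] by simp
    then have w: "wft (LWhisk ?i a t)" "wft (LWhisk ?i a (Comp s t))"
        "wft (Comp (LWhisk ?i a s) (LWhisk ?i a t))"
      using ws 4 by simp_all
    show ?thesis using 4 a i w ws
      by (simp add: New_eqI[OF term_ax.lwhisk_comp] del: del)
  qed
next
  fix k l i j u v w
  assume d: "i < j" "min k l = Suc j" and vw: "composable F k l v w"
    and vu: "composable F k (Suc i) v u"
  let ?i = "Suc i"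
  note del = wf_term.simps(3-5)
  have i: "?i \<le> n"
    using vw d by (cases rule: F_composable_cases) auto
  obtain a where a: "u = Old a" "a \<in> cells C ?i"
    using vu i by (auto simp: composable_def elim!: F_cell_cases)
  show "cmp F (max k l) ?i (cmp F k l v w) u = cmp F k l (cmp F k ?i v u) (cmp F l ?i w u)"
  proof (cases rule: F_composable_cases[OF vw])
    case (1 b c)
    then show ?thesis using vu a i d cmp_distrib_right[of k l i j b c a] by simp
  next
    case (2 b t)
    then have kl: "max k l = Suc n" "?i < k" "l = Suc n" "min k n = Suc j" using d by auto
    have ba: "composable C k ?i b a" using vu a 2 i by simp
    have bt: "composable C k n b (src t)" using 2 by simp
    have ta: "composable C n ?i (src t) a"
      by (rule composable_distrib_right'[OF bt kl(4) d(1) _ _ ba]) (use 2 in auto)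
    note c = composable_distrib_right[OF bt kl(4) d(1) _ _ ta]
    have wt: "wft (RWhisk ?i t a)" using ta 2 i unfolding wf_RWhisk[of _ _ _ Minus] by simp
    have w: "wft (RWhisk ?i (LWhisk k b t) a)"
      using c(2) 2 i unfolding wf_RWhisk[of ?i "LWhisk k b t" a Minus] by (simp add: max_def)
    have w': "wft (LWhisk k (cmp C k ?i b a) (RWhisk ?i t a))"
      using c(3) 2 wt by simp
    show ?thesis using 2 a kl i w w' wt ba
      by (simp add: New_eqI[OF term_ax.rwhisk_lwhisk] del: del)
  next
    case (3 t b)
    then have kl: "max k l = Suc n" "?i < l" "k = Suc n" "min n l = Suc j" using d by auto
    have wt: "wft (RWhisk ?i t a)" using vu a 3 i by simp
    then have ta: "composable C n ?i (tgt t) a" by simp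
    have tb: "composable C n l (tgt t) b" using 3 by simp
    have ba: "composable C l ?i b a"
      by (rule composable_distrib_right'[OF tb kl(4) d(1) _ _ ta]) (use 3 in auto)
    note c = composable_distrib_right[OF tb kl(4) d(1) _ _ ba]
    have w: "wft (RWhisk ?i (RWhisk l t b) a)" "wft (RWhisk l (RWhisk ?i t a) (cmp C l ?i b a))"
      using c 3 i wt by (simp_all add: max_def)
    show ?thesis using 3 a kl i w wt ba
      by (simp add: New_eqI[OF term_ax.rwhisk_rwhisk] del: del)
  next
    case (4 s t)
    then have ws: "wft (RWhisk ?i s a)" using vu a i by simp
    then have "composable C n ?i (src t) a" using 4 by simp
    then have wt: "wft (RWhisk ?i t a)" using 4 i unfolding wf_RWhisk[of _ _ _ Minus] by simp
    then have w: "wft (RWhisk ?i (Comp s t) a)" "wft (Comp (RWhisk ?i s a) (RWhisk ?i t a))"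
      using ws 4 by simp_all
    show ?thesis using 4 a i w ws wt
      by (simp add: New_eqI[OF term_ax.rwhisk_comp] del: del)
  qed
qed

end

primrec teval :: "nat \<Rightarrow> 'b precat \<Rightarrow> (nat \<Rightarrow> 'a \<Rightarrow> 'b) \<Rightarrow> 'a pterm \<Rightarrow> 'b" where
  "teval n D f (Gen x) = f (Suc n) x"
| "teval n D f (Ident a) = idn D n (f n a)"
| "teval n D f (LWhisk k a t) = cmp D k (Suc n) (f k a) (teval n D f t)"
| "teval n D f (RWhisk k t a) = cmp D (Suc n) k (teval n D f t) (f k a)"
| "teval n D f (Comp s t) = cmp D (Suc n) (Suc n) (teval n D f s) (teval n D f t)"

locale precategory_plus_map = precategory_plus n C + D: precategory "Suc n" D
  for n :: nat and C :: "'a precat" and D :: "'b precat" +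
  fixes f :: "nat \<Rightarrow> 'a \<Rightarrow> 'b"
  assumes f_fun: "prefunctor n C D f" and f_glob: "globular_map (Suc n) C D f"
begin

abbreviation "ev \<equiv> teval n D f"

lemma f_cell: "k \<le> Suc n \<Longrightarrow> u \<in> cells C k \<Longrightarrow> f k u \<in> cells D k"
  using f_glob unfolding globular_map_def by blast

lemma f_bd: "k \<le> n \<Longrightarrow> u \<in> cells C (Suc k) \<Longrightarrow> bd D e k (f (Suc k) u) = f k (bd C e k u)"
  using f_glob unfolding globular_map_def by simp

lemma f_idn: "k < n \<Longrightarrow> u \<in> cells C k \<Longrightarrow> f (Suc k) (idn C k u) = idn D k (f k u)"
  using f_fun unfolding prefunctor_def by blast

lemma f_cmp: "k \<le> n \<Longrightarrow> l \<le> n \<Longrightarrow> composable C k l u v \<Longrightarrow>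
    f (max k l) (cmp C k l u v) = cmp D k l (f k u) (f l v)"
  using f_fun unfolding prefunctor_def by blast

lemma f_composable: "k \<le> n \<Longrightarrow> l \<le> n \<Longrightarrow> composable C k l u v \<Longrightarrow> composable D k l (f k u) (f l v)"
  using globular_map_composable[of n C D f k l u v] f_fun globular_set_axioms
  unfolding prefunctor_def by simp

lemma composable_D_left:
  assumes "composable C k n a (src t)" "k \<le> n" "x \<in> cells D (Suc n)" "bd D Minus n x = f n (src t)"
  shows "composable D k (Suc n) (f k a) x"
  using f_composable[OF assms(2) _ assms(1)] assms by (simp add: composable_def min_def)

lemma composable_D_right:
  assumes "composable C n k (tgt t) a" "k \<le> n" "x \<in> cells D (Suc n)" "bd D Plus n x = f n (tgt t)"
  shows "composable D (Suc n) k x (f k a)"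
proof -
  have "min n k = k" "min (Suc n) k = k" using assms(2) by auto
  then show ?thesis
    using f_composable[OF _ assms(2) assms(1)] assms by (simp add: composable_def)
qed

lemma ev_props: "wft t \<Longrightarrow> ev t \<in> cells D (Suc n) \<and> (\<forall>e. bd D e n (ev t) = f n (tbd n C e t))"
proof (induction t)
  case (LWhisk k a t)
  then have IH: "ev t \<in> cells D (Suc n)" "\<And>e. bd D e n (ev t) = f n (tbd n C e t)"
    and k: "k \<le> n" by auto
  have c: "composable C k n a (tbd n C e t)" for e
    using LWhisk.prems unfolding wf_LWhisk[of k a t e] by simp
  have d: "composable D k (Suc n) (f k a) (ev t)"
    using composable_D_left[OF c[of Minus] k IH] .
  show ?case
    using D.cmp_cell[OF _ _ d] D.bd_cmp_less[OF _ _ d] f_cmp[OF k _ c] k IH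
    by (simp add: max_def)
next
  case (RWhisk k t a)
  then have IH: "ev t \<in> cells D (Suc n)" "\<And>e. bd D e n (ev t) = f n (tbd n C e t)"
    and k: "k \<le> n" by auto
  have c: "composable C n k (tbd n C e t) a" for e
    using RWhisk.prems unfolding wf_RWhisk[of k t a e] by simp
  have d: "composable D (Suc n) k (ev t) (f k a)"
    using composable_D_right[OF c[of Plus] k IH] .
  have m: "max (Suc n) k = Suc n" "max n k = n" using k by auto
  show ?case
    using D.cmp_cell[OF _ _ d] D.bd_cmp_greater[OF _ _ d] f_cmp[OF _ k c] k IH
    by (simp add: m)
next
  case (Comp s t)
  then have d: "composable D (Suc n) (Suc n) (ev s) (ev t)"
    by (simp add: composable_def)
  show ?case
    using Comp D.cmp_cell[OF _ _ d] D.bd_cmp_Minus[OF _ d] D.bd_cmp_Plus[OF _ d]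
    by (auto split: sgn.splits)
qed (auto simp: f_cell f_bd D.idn_cell D.bd_idn)

lemma ev_LWhisk: "wft (LWhisk k a t) \<Longrightarrow>
    composable D k (Suc n) (f k a) (ev t) \<and> composable C k n a (tbd n C e t) \<and> k \<le> n \<and> 0 < k \<and> wft t"
  using composable_D_left[of k a t "ev t"] ev_props[of t] wf_LWhisk[of k a t e]
    composableD[of k n a "src t"]
  by (metis wf_term.simps(3))

lemma ev_RWhisk: "wft (RWhisk k t a) \<Longrightarrow>
    composable D (Suc n) k (ev t) (f k a) \<and> composable C n k (tbd n C e t) a \<and> k \<le> n \<and> 0 < k \<and> wft t"
  using composable_D_right[of k t a "ev t"] ev_props[of t] wf_RWhisk[of k t a e]
    composableD[of n k "tgt t" a]
  by (metis wf_term.simps(4))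

lemma ev_Comp: "wft (Comp s t) \<Longrightarrow> composable D (Suc n) (Suc n) (ev s) (ev t) \<and> wft s \<and> wft t"
  using ev_props[of s] ev_props[of t] by (auto simp: composable_def)

lemma term_ax_ev:
  assumes "term_ax n C s t" "wft s" "wft t"
  shows "ev s = ev t"
  using assms
proof (cases rule: term_ax.cases)
  case (comp_ident_left a)
  then show ?thesis using assms ev_Comp[of "Ident a" t] D.idn_cmp_le[of "Suc n" n "f n a" "ev t"]
    by (auto simp: f_cell)
next
  case (comp_ident_right a)
  then show ?thesis using assms ev_Comp[of t "Ident a"] D.cmp_idn_le[of "Suc n" n "f n a" "ev t"]
    by (auto simp: f_cell)
next
  case (lwhisk_idn j a)
  then have "wft (LWhisk (Suc j) (idn C j a) t)" using assms by simp
  from ev_LWhisk[OF this, of Minus] show ?thesis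
    using lwhisk_idn D.idn_cmp_le[of "Suc n" j "f j a" "ev t"] by (simp add: f_cell f_idn)
next
  case (rwhisk_idn j a)
  then have "wft (RWhisk (Suc j) t (idn C j a))" using assms by simp
  from ev_RWhisk[OF this, of Minus] show ?thesis
    using rwhisk_idn D.cmp_idn_le[of "Suc n" j "f j a" "ev t"] by (simp add: f_cell f_idn)
next
  case (lwhisk_ident k b a)
  then have "wft (LWhisk k b (Ident a))" using assms by simp
  from ev_LWhisk[OF this, of Minus] show ?thesis
    using lwhisk_ident D.cmp_idn_gt[of n k "f n a" "f k b"] f_cmp[of k n b a]
    by (simp add: f_cell max_def)
next
  case (rwhisk_ident k a b)
  then have "wft (RWhisk k (Ident a) b)" using assms by simp
  from ev_RWhisk[OF this, of Minus] show ?thesis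
    using rwhisk_ident D.idn_cmp_gt[of n k "f n a" "f k b"] f_cmp[of n k a b]
    by (simp add: f_cell max_def split: if_splits)
next
  case (comp_assoc r s t)
  then have "wft (Comp (Comp r s) t)" "wft (Comp r (Comp s t))" using assms by auto
  from this[THEN ev_Comp] show ?thesis
    using comp_assoc D.cmp_assoc[of "Suc n" "Suc n" "Suc n" n "ev r" "ev s" "ev t"]
      ev_Comp[of r s] ev_Comp[of s t]
    by (simp del: wf_term.simps(3-5))
next
  case (lwhisk_cmp k a b t)
  then have w: "wft (LWhisk k (cmp C k k a b) t)" "wft (LWhisk k a (LWhisk k b t))"
    "wft (LWhisk k b t)" using assms by auto
  from w[THEN ev_LWhisk, of Minus] obtain i where "k = Suc i" by (cases k) auto
  with w[THEN ev_LWhisk, of Minus] lwhisk_cmp show ?thesis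
    using D.cmp_assoc[of k k "Suc n" i "f k a" "f k b" "ev t"] f_cmp[of k k a b]
      f_composable[of k k a b]
    by (simp add: max_def min_def split: if_splits)
next
  case (whisk_assoc k a t b)
  then have w: "wft (LWhisk k a t)" "wft (LWhisk k a (RWhisk k t b))" "wft (RWhisk k t b)"
    "wft (RWhisk k (LWhisk k a t) b)" using assms by auto
  from ev_LWhisk[OF w(1), of Minus] obtain i where "k = Suc i" by (cases k) auto
  with w(1,2)[THEN ev_LWhisk, of Minus] w(3,4)[THEN ev_RWhisk, of Minus] whisk_assoc show ?thesis
    using D.cmp_assoc[of k "Suc n" k i "f k a" "ev t" "f k b"]
    by (simp add: max_def min_def split: if_splits)
next
  case (rwhisk_cmp k a b t)
  then have w: "wft (RWhisk k t (cmp C k k a b))" "wft (RWhisk k (RWhisk k t a) b)"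
    "wft (RWhisk k t a)" using assms by auto
  from w[THEN ev_RWhisk, of Minus] obtain i where "k = Suc i" by (cases k) auto
  with w[THEN ev_RWhisk, of Minus] rwhisk_cmp show ?thesis
    using D.cmp_assoc[of "Suc n" k k i "ev t" "f k a" "f k b"] f_cmp[of k k a b]
      f_composable[of k k a b]
    by (simp add: max_def min_def split: if_splits)
next
  case (lwhisk_comp k a s t)
  then have w: "wft (LWhisk k a s)" "wft (Comp s t)" using assms by auto
  from ev_LWhisk[OF w(1), of Minus] obtain i where i: "k = Suc i" "i < n" by (cases k) auto
  with ev_LWhisk[OF w(1), of Minus] ev_Comp[OF w(2)] lwhisk_comp show ?thesis
    using D.cmp_distrib_left[of "Suc n" "Suc n" i n "ev s" "ev t" "f k a"] by simp
next
  case (rwhisk_comp k s t a)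
  then have w: "wft (RWhisk k s a)" "wft (Comp s t)" using assms by auto
  from ev_RWhisk[OF w(1), of Minus] obtain i where i: "k = Suc i" "i < n" by (cases k) auto
  with ev_RWhisk[OF w(1), of Minus] ev_Comp[OF w(2)] rwhisk_comp show ?thesis
    using D.cmp_distrib_right[of "Suc n" "Suc n" i n "ev s" "ev t" "f k a"] by simp
next
  case (lwhisk_lwhisk k l a b t)
  then have w: "wft (LWhisk l b t)" using assms by auto
  have "0 < k" "0 < l" using lwhisk_lwhisk composableD by blast+
  then obtain i j where "k = Suc i" "l = Suc j" by (cases k; cases l) auto
  then show ?thesis
    using D.cmp_distrib_left[of l "Suc n" i j "f l b" "ev t" "f k a"] f_cmp[of k l a b]
      f_composable[of k l a b] lwhisk_lwhisk ev_LWhisk[OF w, of Minus]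
    by (simp add: max_def min_def split: if_splits)
next
  case (lwhisk_rwhisk k l a b t)
  then have w: "wft (RWhisk l t b)" "wft (LWhisk k a t)" using assms by auto
  have "0 < k" "0 < l" using lwhisk_rwhisk composableD by blast+
  then obtain i j where "k = Suc i" "l = Suc j" by (cases k; cases l) auto
  then show ?thesis
    using D.cmp_distrib_left[of "Suc n" l i j "ev t" "f l b" "f k a"] f_cmp[of k l a b]
      lwhisk_rwhisk ev_RWhisk[OF w(1), of Minus] ev_LWhisk[OF w(2), of Minus]
    by (simp add: max_def min_def split: if_splits)
next
  case (rwhisk_lwhisk k l b a t)
  then have w: "wft (LWhisk l b t)" "wft (RWhisk k t a)" using assms by auto
  have "0 < k" "0 < l" using rwhisk_lwhisk composableD by blast+
  then obtain i j where "k = Suc i" "l = Suc j" by (cases k; cases l) auto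
  then show ?thesis
    using D.cmp_distrib_right[of l "Suc n" i j "f l b" "ev t" "f k a"] f_cmp[of l k b a]
      f_composable[of l k b a] rwhisk_lwhisk ev_LWhisk[OF w(1), of Minus] ev_RWhisk[OF w(2), of Minus]
    by (simp add: max_def min_def split: if_splits)
next
  case (rwhisk_rwhisk k l b a t)
  then have w: "wft (RWhisk l t b)" "wft (RWhisk k t a)"
    "wft (RWhisk k (RWhisk l t b) a)" "wft (RWhisk l (RWhisk k t a) (cmp C l k b a))"
    using assms by auto
  have "0 < k" "0 < l" using rwhisk_rwhisk composableD by blast+
  then obtain i j where "k = Suc i" "l = Suc j" by (cases k; cases l) auto
  then show ?thesis
    using D.cmp_distrib_right[of "Suc n" l i j "ev t" "f l b" "f k a"] f_cmp[of l k b a]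
      rwhisk_rwhisk w[THEN ev_RWhisk, of Minus]
    by (simp add: max_def min_def split: if_splits)
qed

lemma term_eq_ev: "teq s t \<Longrightarrow> ev s = ev t"
  by (induction rule: term_eq.induct) (auto dest: term_ax_ev)

definition ext :: "nat \<Rightarrow> 'a fcell \<Rightarrow> 'b" where
  "ext k x = (case x of Old a \<Rightarrow> f k a | New X \<Rightarrow> ev (term_rep X))"

lemma ext_simps [simp]: "ext k (Old a) = f k a" "wft t \<Longrightarrow> ext k (New (cl t)) = ev t"
  using term_eq_ev[OF rep_cl[of t]] by (auto simp: ext_def)

lemma prefunctor_ext: "prefunctor (Suc n) F D ext"
  unfolding prefunctor_def globular_map_def
proof (intro conjI allI impI ballI)
  fix k u assume "u \<in> cells F k"
  then show "ext k u \<in> cells D k"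
    by (cases rule: F_cell_cases) (auto simp: f_cell ev_props)
next
  fix k u e assume "k < Suc n" "u \<in> cells F (Suc k)"
  then show "ext k (bd F e k u) = bd D e k (ext (Suc k) u)"
    by (auto simp: f_bd ev_props elim!: F_cell_cases)
next
  fix k u assume "k < Suc n" "u \<in> cells F k"
  then show "ext (Suc k) (idn F k u) = idn D k (ext k u)"
    by (cases "k = n") (auto simp: f_idn elim!: F_cell_cases)
next
  fix k l u v assume "composable F k l u v"
  then show "ext (max k l) (cmp F k l u v) = cmp D k l (ext k u) (ext l v)"
  proof (cases rule: F_composable_cases)
    case (4 s t)
    then have "wft s" "wft t" by simp_all
    then show ?thesis using 4 by (simp del: wf_term.simps(5))
  next
    case (2 a t)
    then show ?thesis using ev_LWhisk[of k a t Minus] by (simp add: max_def del: wf_term.simps(3))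
  next
    case (3 t a)
    then show ?thesis using ev_RWhisk[of l t a Minus] by (simp add: max_def del: wf_term.simps(4))
  qed (auto simp: f_cmp)
qed

lemma ext_incl: "k \<le> Suc n \<Longrightarrow> x \<in> cells C k \<Longrightarrow> ext k (free_incl n C k x) = f k x"
  by (cases "k = Suc n") (auto simp: free_incl_def)

lemma ext_unique:
  assumes g: "prefunctor (Suc n) F D g"
    and g_incl: "\<And>k x. k \<le> Suc n \<Longrightarrow> x \<in> cells C k \<Longrightarrow> g k (free_incl n C k x) = f k x"
    and k: "k \<le> Suc n" and x: "x \<in> cells F k"
  shows "g k x = ext k x"
proof -
  have old: "g k (Old a) = f k a" if "k \<le> n" "a \<in> cells C k" for k a
    using g_incl[of k a] that by (simp add: free_incl_def)
  have idn: "g (Suc n) (idn F n u) = idn D n (g n u)" if "u \<in> cells F n" for u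
    using g that unfolding prefunctor_def by auto
  have cmp: "g (max k l) (cmp F k l u v) = cmp D k l (g k u) (g l v)"
    if "k \<le> Suc n" "l \<le> Suc n" "composable F k l u v" for k l u v
    using g that unfolding prefunctor_def by blast
  have new: "wft t \<Longrightarrow> g (Suc n) (New (cl t)) = ev t" for t
  proof (induction t)
    case (Gen x)
    then show ?case using g_incl[of "Suc n" x] by (simp add: free_incl_def)
  next
    case (Ident a)
    then show ?case using idn[of "Old a"] old[of n a] by simp
  next
    case (LWhisk k a t)
    then have w: "wft t" "k \<le> n" "a \<in> cells C k" by (auto simp: composable_def)
    then show ?case
      using LWhisk cmp[of k "Suc n" "Old a" "New (cl t)"] old[of k a]
      by (simp add: max_def)
  next
    case (RWhisk k t a)
    then have w: "wft t" "k \<le> n" "a \<in> cells C k" by (auto simp: composable_def)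
    then have "max (Suc n) k = Suc n" by simp
    then show ?case
      using RWhisk w cmp[of "Suc n" k "New (cl t)" "Old a"] old[of k a] by simp
  next
    case (Comp s t)
    then show ?case using cmp[of "Suc n" "Suc n" "New (cl s)" "New (cl t)"] by simp
  qed
  show ?thesis using x by (cases rule: F_cell_cases) (auto simp: old new)
qed

end

theorem free_precat_precategory:
  assumes "precategory n C" "globular_set (Suc n) C"
  shows "precategory (Suc n) (free_precat n C)"
  using precategory_plus.precategory_free assms precategory_plus.intro by blast

theorem free_incl_morphism:
  assumes "precategory n C" "globular_set (Suc n) C"
  shows "prefunctor n C (free_precat n C) (free_incl n C)"
    and "globular_map (Suc n) C (free_precat n C) (free_incl n C)"
proof -
  interpret precategory_plus n C using assms by (rule precategory_plus.intro)
  show "globular_map (Suc n) C F (free_incl n C)"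
    unfolding globular_map_def
  proof (intro conjI allI impI ballI)
    fix k u assume "k \<le> Suc n" "u \<in> cells C k"
    then show "free_incl n C k u \<in> cells F k"
      by (cases "k = Suc n") (auto simp: free_incl_def)
  next
    fix k u e assume "k < Suc n" "u \<in> cells C (Suc k)"
    then show "free_incl n C k (bd C e k u) = bd F e k (free_incl n C (Suc k) u)"
      by (cases "k = n") (auto simp: free_incl_def)
  qed
  show "prefunctor n C F (free_incl n C)"
    unfolding prefunctor_def globular_map_def free_incl_def by auto
qed

text \<open>Every morphism of \<open>PCat\<^sub>n\<^sup>+\<close> into an \<open>(n+1)\<close>-precategory extends uniquely along \<open>free_incl\<close>.\<close>

theorem free_precat_universal:
  assumes "precategory n C" "globular_set (Suc n) C" "precategory (Suc n) D"
    and "prefunctor n C D f" "globular_map (Suc n) C D f"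
  shows "\<exists>g. prefunctor (Suc n) (free_precat n C) D g \<and>
      (\<forall>k\<le>Suc n. \<forall>x\<in>cells C k. g k (free_incl n C k x) = f k x) \<and>
      (\<forall>h. prefunctor (Suc n) (free_precat n C) D h \<and>
           (\<forall>k\<le>Suc n. \<forall>x\<in>cells C k. h k (free_incl n C k x) = f k x) \<longrightarrow>
           (\<forall>k\<le>Suc n. \<forall>x\<in>cells (free_precat n C) k. h k x = g k x))"
proof -
  interpret precategory_plus_map n C D f
    using assms by (intro precategory_plus_map.intro precategory_plus.intro
      precategory_plus_map_axioms.intro)
  show ?thesis
    using prefunctor_ext ext_incl ext_unique by (intro exI[of _ ext]) blast
qed

section \<open>Composites of whiskered generators\<close>

text \<open>
  \<open>whisker D N v A w m\<close> is \<open>v\<^sub>m *\<^bsub>m-1\<^esub> (\<dots> (v\<^sub>1 *\<^sub>0 A *\<^sub>0 w\<^sub>1) \<dots>) *\<^bsub>m-1\<^esub> w\<^sub>m\<close> for an \<open>N\<close>-cell \<open>A\<close>, and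
  \<open>whisker_defined\<close> says that all composites occurring in it are defined.
\<close>

primrec whisker ::
    "'b precat \<Rightarrow> nat \<Rightarrow> (nat \<Rightarrow> 'b) \<Rightarrow> 'b \<Rightarrow> (nat \<Rightarrow> 'b) \<Rightarrow> nat \<Rightarrow> 'b" where
  "whisker D N v A w 0 = A"
| "whisker D N v A w (Suc j) =
     cmp D N (Suc j) (cmp D (Suc j) N (v (Suc j)) (whisker D N v A w j)) (w (Suc j))"

primrec whisker_defined ::
    "'b precat \<Rightarrow> nat \<Rightarrow> (nat \<Rightarrow> 'b) \<Rightarrow> 'b \<Rightarrow> (nat \<Rightarrow> 'b) \<Rightarrow> nat \<Rightarrow> bool" where
  "whisker_defined D N v A w 0 \<longleftrightarrow> A \<in> cells D N"
| "whisker_defined D N v A w (Suc j) \<longleftrightarrow>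
     whisker_defined D N v A w j \<and>
     composable D (Suc j) N (v (Suc j)) (whisker D N v A w j) \<and>
     composable D N (Suc j) (cmp D (Suc j) N (v (Suc j)) (whisker D N v A w j)) (w (Suc j))"

text \<open>
  The value for the empty list is irrelevant: the empty composite is an identity on an arbitrary
  \<open>n\<close>-cell, see \<open>decomposes\<close>.
\<close>

fun composite :: "'b precat \<Rightarrow> nat \<Rightarrow> 'b list \<Rightarrow> 'b" where
  "composite D N [] = undefined"
| "composite D N [u] = u"
| "composite D N (u # v # us) = cmp D N N u (composite D N (v # us))"

text \<open>
  A list \<open>[(v\<^sup>1, A\<^sup>1, w\<^sup>1), \<dots>, (v\<^sup>k, A\<^sup>k, w\<^sup>k)]\<close> encodes a decomposition of \<open>u\<close>. The families \<open>v\<^sup>i\<close> and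
  \<open>w\<^sup>i\<close> are extensional functions on \<open>{1..n}\<close>, so that equality of the codes means equality of
  all the cells \<open>A\<^sup>i\<close>, \<open>v\<^sup>i j\<close> and \<open>w\<^sup>i j\<close> with \<open>1 \<le> j \<le> n\<close>.
\<close>

definition whisker_data ::
    "nat \<Rightarrow> 'a precat \<Rightarrow> ((nat \<Rightarrow> 'a) \<times> 'a \<times> (nat \<Rightarrow> 'a)) set" where
  "whisker_data n C =
     (\<Pi>\<^sub>E j\<in>{1..n}. cells C j) \<times> cells C (Suc n) \<times> (\<Pi>\<^sub>E j\<in>{1..n}. cells C j)"

definition decomposes ::
    "nat \<Rightarrow> 'a precat \<Rightarrow> 'a fcell \<Rightarrow> ((nat \<Rightarrow> 'a) \<times> 'a \<times> (nat \<Rightarrow> 'a)) list \<Rightarrow> bool" where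
  "decomposes n C u ds \<longleftrightarrow>
     (let F = free_precat n C;
          inc = free_incl n C;
          us = map (\<lambda>(v, A, w). whisker F (Suc n) (\<lambda>j. inc j (v j)) (inc (Suc n) A)
                                  (\<lambda>j. inc j (w j)) n) ds
      in (\<forall>(v, A, w)\<in>set ds. whisker_defined F (Suc n) (\<lambda>j. inc j (v j)) (inc (Suc n) A)
                                (\<lambda>j. inc j (w j)) n) \<and>
         (if ds = [] then \<exists>a\<in>cells F n. u = idn F n a
          else successively (composable F (Suc n) (Suc n)) us \<and> u = composite F (Suc n) us))"

end

(*
  Whiskering a generator with a cell of dimension k only affects the whiskers of dimension at least k:
  distributivity pushes the new cell under those of dimension > k, and associativity absorbs it in
  the one of dimension k on the same side. Reading this off syntactically gives a function nf from
  formal composites to lists of whiskered generators. Every axiom of precategories, at the level of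
  terms, becomes an axiom of C at the level of whiskers, so nf is well defined on cells. It recovers
  any decomposition of a cell, which is uniqueness; and every cell is the composite of its normal
  form, which is existence. Left and right whiskering are treated together, indexed by a sign.
*)

theory Submission
  imports Defs
begin

section \<open>Whiskering on either side\<close>

text \<open>A cell attached at the source of \<open>x\<close> meets it along its own target, and
  conversely; hence the opposite sign.\<close>

primrec opp :: "sgn \<Rightarrow> sgn" where
  "opp Minus = Plus"
| "opp Plus = Minus"

text \<open>The sign is that of the boundary of \<open>x\<close> at which \<open>a\<close> is
  attached: \<open>Minus\<close> is whiskering on the left, \<open>Plus\<close> on the right. The
  whisker comes first for both signs, so that each pair of mirrored axioms becomes a single
  statement.\<close>

definition wcmp :: "'a precat \<Rightarrow> sgn \<Rightarrow> nat \<Rightarrow> nat \<Rightarrow> 'a \<Rightarrow> 'a \<Rightarrow> 'a" where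
  "wcmp C e k l a x = (case e of Minus \<Rightarrow> cmp C k l a x | Plus \<Rightarrow> cmp C l k x a)"

definition wcomp :: "'a precat \<Rightarrow> sgn \<Rightarrow> nat \<Rightarrow> nat \<Rightarrow> 'a \<Rightarrow> 'a \<Rightarrow> bool" where
  "wcomp C e k l a x = (case e of Minus \<Rightarrow> composable C k l a x | Plus \<Rightarrow> composable C l k x a)"

lemma wcomp_iff:
  assumes "j < l"
  shows "wcomp C e (Suc j) l a x \<longleftrightarrow>
    a \<in> cells C (Suc j) \<and> x \<in> cells C l \<and> bd C (opp e) j a = bds C e j l x"
proof -
  have "min (Suc j) l = Suc j" "min l (Suc j) = Suc j" using assms by auto
  then show ?thesis using assms by (cases e) (auto simp: wcomp_def composable_def)
qed

context precategory
begin

lemma wcmp_cell: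
  assumes "j < l" "l \<le> n" "wcomp C e (Suc j) l a x"
  shows "wcmp C e (Suc j) l a x \<in> cells C l"
proof -
  have "max (Suc j) l = l" "max l (Suc j) = l" using assms by auto
  then show ?thesis
    using assms cmp_cell[of "Suc j" l a x] cmp_cell[of l "Suc j" x a]
    by (cases e) (auto simp: wcomp_def wcmp_def)
qed

section \<open>Boundaries of a whiskered cell\<close>

lemma bds_wcmp_above:
  assumes "j < i" "i \<le> l" "l \<le> n" "wcomp C e (Suc j) l a x"
  shows "bds C e' i l (wcmp C e (Suc j) l a x) = wcmp C e (Suc j) i a (bds C e' i l x)"
  using assms bds_cmp_left[of j l a x i e'] bds_cmp_right[of l j x a i e']
  by (cases e) (auto simp: wcomp_def wcmp_def)

lemma bds_wcmp_same:
  assumes "j < l" "l \<le> n" "wcomp C e (Suc j) l a x"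
  shows "bds C e j l (wcmp C e (Suc j) l a x) = bd C e j a"
proof -
  have "max (Suc j) l = l" "max l (Suc j) = l" "min (Suc j) l = Suc j" "min l (Suc j) = Suc j"
    using assms by auto
  then show ?thesis
    using assms bds_cmp_ends[of "Suc j" l a x j] bds_cmp_ends[of l "Suc j" x a j]
    by (cases e) (auto simp: wcomp_def wcmp_def)
qed

text \<open>Attaching \<open>a\<close> on side \<open>e\<close> replaces the
  \<open>j\<close>-dimensional boundary of \<open>x\<close> on that side only. The opposite one
  belongs to the far end of the composite, and lower boundaries agree by globularity.\<close>

lemma bds_wcmp_below:
  assumes "j < l" "l \<le> n" "wcomp C e (Suc j) l a x" "i < j \<or> i = j \<and> e' \<noteq> e"
  shows "bds C e' i l (wcmp C e (Suc j) l a x) = bds C e' i l x"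
proof -
  have m: "max (Suc j) l = l" "max l (Suc j) = l" "min (Suc j) l = Suc j" "min l (Suc j) = Suc j"
    using assms by auto
  show ?thesis
  proof (cases e)
    case Minus
    have c: "composable C (Suc j) l a x" using assms Minus by (simp add: wcomp_def)
    show ?thesis
    proof (cases "i < j")
      case True
      then show ?thesis
        using bds_cmp_lower[OF c, of j i e'] composable_bds_eq[OF c, of j i e'] assms m Minus
        by (simp add: wcmp_def)
    next
      case False
      then have "i = j" "e' = Plus" using assms(4) Minus by (auto intro: sgn.exhaust)
      then show ?thesis using bds_cmp_ends[OF c, of j] assms m Minus by (simp add: wcmp_def)
    qed
  next
    case Plus
    have c: "composable C l (Suc j) x a" using assms Plus by (simp add: wcomp_def)
    show ?thesis
    proof (cases "i < j")
      case True
      then show ?thesis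
        using bds_cmp_lower[OF c, of j i e'] assms m Plus
        by (simp add: wcmp_def)
    next
      case False
      then have "i = j" "e' = Minus" using assms(4) Plus by (auto intro: sgn.exhaust)
      then show ?thesis using bds_cmp_ends[OF c, of j] assms m Plus by (simp add: wcmp_def)
    qed
  qed
qed

section \<open>The precategory axioms for whiskering on either side\<close>

lemma wcmp_idn_left:
  assumes "j < l" "l \<le> n" "a \<in> cells C j" "wcomp C e (Suc j) l (idn C j a) x"
  shows "wcmp C e (Suc j) l (idn C j a) x = x"
  using assms idn_cmp_le[of l j a x] cmp_idn_le[of l j a x]
  by (cases e) (auto simp: wcomp_def wcmp_def)

lemma wcmp_idn_right:
  assumes "j < l" "l < n" "x \<in> cells C l" "wcomp C e (Suc j) (Suc l) a (idn C l x)"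
  shows "wcmp C e (Suc j) (Suc l) a (idn C l x) = idn C l (wcmp C e (Suc j) l a x)"
  using assms idn_cmp_gt[of l "Suc j" x a] cmp_idn_gt[of l "Suc j" x a]
  by (cases e) (auto simp: wcomp_def wcmp_def)

lemma wcmp_idn_same:
  assumes "j < n" "x \<in> cells C j" "wcomp C e (Suc j) (Suc j) a (idn C j x)"
  shows "wcmp C e (Suc j) (Suc j) a (idn C j x) = a"
  using assms idn_cmp_le[of "Suc j" j x a] cmp_idn_le[of "Suc j" j x a]
  by (cases e) (auto simp: wcomp_def wcmp_def)

lemma wcomp_wcmp:
  assumes "j < l" "l \<le> n" "wcomp C e (Suc j) (Suc j) a b" "wcomp C e (Suc j) l b x"
  shows "wcomp C e (Suc j) l (wcmp C e (Suc j) (Suc j) a b) x"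
    and "wcomp C e (Suc j) l a (wcmp C e (Suc j) l b x)"
proof -
  have "wcmp C e (Suc j) (Suc j) a b \<in> cells C (Suc j)" "wcmp C e (Suc j) l b x \<in> cells C l"
    using assms by (auto intro: wcmp_cell)
  then show "wcomp C e (Suc j) l (wcmp C e (Suc j) (Suc j) a b) x"
    "wcomp C e (Suc j) l a (wcmp C e (Suc j) l b x)"
    using assms bds_wcmp_below[of j "Suc j" e a b j "opp e"] bds_wcmp_same[of j l e b x]
    by (cases e; auto simp: wcomp_iff)+
qed

text \<open>Associativity in the form of an action. On the right, \<open>wcmp C Plus\<close>
  reverses the factors, so the order of \<open>a\<close> and \<open>b\<close> comes out the same for
  both signs.\<close>

lemma wcmp_assoc:
  assumes "j < l" "l \<le> n" "wcomp C e (Suc j) (Suc j) a b" "wcomp C e (Suc j) l b x"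
  shows "wcmp C e (Suc j) l (wcmp C e (Suc j) (Suc j) a b) x =
    wcmp C e (Suc j) l a (wcmp C e (Suc j) l b x)"
proof -
  have m: "max (Suc j) l = l" "max l (Suc j) = l" "min (Suc j) l = Suc j" "min l (Suc j) = Suc j"
    using assms by auto
  show ?thesis
    using assms wcomp_wcmp[OF assms] m cmp_assoc[of "Suc j" "Suc j" l j a b x]
      cmp_assoc[of l "Suc j" "Suc j" j x b a]
    by (cases e) (auto simp: wcomp_def wcmp_def)
qed

lemma wcomp_swap:
  assumes "j < l" "l \<le> n" "wcomp C e (Suc j) l a x" "wcomp C e' (Suc j) l b x" "e \<noteq> e'"
  shows "wcomp C e (Suc j) l a (wcmp C e' (Suc j) l b x)"
  using assms bds_wcmp_below[of j l e' b x j e] wcmp_cell[of j l e' b x] by (auto simp: wcomp_iff)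

text \<open>Associativity with \<open>x\<close> in the middle.\<close>

lemma wcmp_swap:
  assumes "j < l" "l \<le> n" "wcomp C e (Suc j) l a x" "wcomp C e' (Suc j) l b x" "e \<noteq> e'"
  shows "wcmp C e (Suc j) l a (wcmp C e' (Suc j) l b x) =
    wcmp C e' (Suc j) l b (wcmp C e (Suc j) l a x)"
proof -
  have m: "max (Suc j) l = l" "max l (Suc j) = l" "min (Suc j) l = Suc j" "min l (Suc j) = Suc j"
    using assms by auto
  show ?thesis
    using assms wcomp_swap[OF assms] wcomp_swap[of j l e' b x e a] m
      cmp_assoc[of "Suc j" l "Suc j" j a x b] cmp_assoc[of "Suc j" l "Suc j" j b x a]
    by (cases e; cases e') (auto simp: wcomp_def wcmp_def)
qed

text \<open>Cells composable along dimension \<open>i\<close> share an \<open>i\<close>-dimensional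
  boundary, hence by globularity all lower ones.\<close>

lemma wcomp_bds_eq:
  assumes "j < i" "i < l" "l \<le> n" "wcomp C e (Suc i) l b x"
  shows "bds C e' j (Suc i) b = bds C e' j l x"
proof -
  have m: "min (Suc i) l = Suc i" "min l (Suc i) = Suc i"
    using assms by auto
  then show ?thesis
    using assms composable_bds_eq[of "Suc i" l b x i j e'] composable_bds_eq[of l "Suc i" x b i j e']
    by (cases e) (auto simp: wcomp_def)
qed

lemma wcomp_distrib:
  assumes "j < i" "i < l" "l \<le> n" "wcomp C e' (Suc i) l b x" "wcomp C e (Suc j) l a x"
  shows "wcomp C e (Suc j) (Suc i) a b"
    and "wcomp C e (Suc j) l a (wcmp C e' (Suc i) l b x)"
    and "wcomp C e' (Suc i) l (wcmp C e (Suc j) (Suc i) a b) (wcmp C e (Suc j) l a x)"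
proof -
  show 1: "wcomp C e (Suc j) (Suc i) a b"
    using assms wcomp_bds_eq[OF assms(1-4)] by (auto simp: wcomp_iff)
  show "wcomp C e (Suc j) l a (wcmp C e' (Suc i) l b x)"
    using assms bds_wcmp_below[of i l e' b x j e] wcmp_cell[of i l e' b x] by (auto simp: wcomp_iff)
  have "bds C (opp e') i (Suc i) (wcmp C e (Suc j) (Suc i) a b) =
      bds C e' i l (wcmp C e (Suc j) l a x)"
    using assms 1 bds_wcmp_above[of j i "Suc i" e a b "opp e'"] bds_wcmp_above[of j i l e a x e']
    by (auto simp: wcomp_iff)
  then show "wcomp C e' (Suc i) l (wcmp C e (Suc j) (Suc i) a b) (wcmp C e (Suc j) l a x)"
    using assms 1 wcmp_cell[of j "Suc i" e a b] wcmp_cell[of j l e a x] by (simp add: wcomp_iff)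
qed

text \<open>The four sign combinations are the two distributivity axioms, each with the cell of
  dimension \<open>l\<close> in either position. The low-dimensional whisker \<open>a\<close> moves
  past the higher one \<open>b\<close> and acts on it on the way.\<close>

lemma wcmp_distrib:
  assumes "j < i" "i < l" "l \<le> n" "wcomp C e' (Suc i) l b x" "wcomp C e (Suc j) l a x"
  shows "wcmp C e (Suc j) l a (wcmp C e' (Suc i) l b x) =
    wcmp C e' (Suc i) l (wcmp C e (Suc j) (Suc i) a b) (wcmp C e (Suc j) l a x)"
proof -
  have m: "max (Suc i) l = l" "max l (Suc i) = l" "min (Suc i) l = Suc i" "min l (Suc i) = Suc i"
    using assms by auto
  show ?thesis
    using assms wcomp_distrib(1)[OF assms] m
      cmp_distrib_left[of "Suc i" l j i b x a] cmp_distrib_left[of l "Suc i" j i x b a]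
      cmp_distrib_right[of "Suc i" l j i b x a] cmp_distrib_right[of l "Suc i" j i x b a]
    by (cases e; cases e') (auto simp: wcomp_def wcmp_def)
qed

end


section \<open>Families of whiskers\<close>

text \<open>
  A family \<open>z\<close> holds the left whiskers \<open>z Minus i\<close> and the right whiskers \<open>z Plus i\<close> of dimensions
  \<open>1 \<le> i \<le> m\<close>; \<open>act\<close> is what whiskering the whole composite with the \<open>k\<close>-cell \<open>a\<close> on side \<open>e\<close> does
  to it. \<open>fill\<close> extends the whiskers up to dimension \<open>j\<close> by the identities composable with \<open>x\<close>.
\<close>

definition act :: "'a precat \<Rightarrow> nat \<Rightarrow> sgn \<Rightarrow> nat \<Rightarrow> 'a \<Rightarrow> (sgn \<Rightarrow> nat \<Rightarrow> 'a) \<Rightarrow> sgn \<Rightarrow> nat \<Rightarrow> 'a" where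
  "act C m e k a z = (\<lambda>e' i.
     if i \<le> m \<and> (k < i \<or> k = i \<and> e' = e) then wcmp C e k i a (z e' i) else z e' i)"

definition fill :: "'a precat \<Rightarrow> nat \<Rightarrow> nat \<Rightarrow> (sgn \<Rightarrow> nat \<Rightarrow> 'a) \<Rightarrow> nat \<Rightarrow> 'a \<Rightarrow> sgn \<Rightarrow> nat \<Rightarrow> 'a" where
  "fill C n m z j x = (\<lambda>e i. if i = 0 \<or> m < i then undefined else if i \<le> j then z e i
     else idn C (i - 1) (bds C e (i - 1) n x))"

abbreviation whisk :: "'a precat \<Rightarrow> nat \<Rightarrow> (sgn \<Rightarrow> nat \<Rightarrow> 'a) \<Rightarrow> 'a \<Rightarrow> nat \<Rightarrow> 'a" where
  "whisk C n z A \<equiv> whisker C n (z Minus) A (z Plus)"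

abbreviation whisk_defined :: "'a precat \<Rightarrow> nat \<Rightarrow> (sgn \<Rightarrow> nat \<Rightarrow> 'a) \<Rightarrow> 'a \<Rightarrow> nat \<Rightarrow> bool" where
  "whisk_defined C n z A \<equiv> whisker_defined C n (z Minus) A (z Plus)"

lemma whisk_Suc:
  "whisk C n z A (Suc j) =
    wcmp C Plus (Suc j) n (z Plus (Suc j)) (wcmp C Minus (Suc j) n (z Minus (Suc j)) (whisk C n z A j))"
  by (simp add: wcmp_def)

lemma whisk_defined_Suc:
  "whisk_defined C n z A (Suc j) \<longleftrightarrow> whisk_defined C n z A j \<and>
    wcomp C Minus (Suc j) n (z Minus (Suc j)) (whisk C n z A j) \<and>
    wcomp C Plus (Suc j) n (z Plus (Suc j)) (wcmp C Minus (Suc j) n (z Minus (Suc j)) (whisk C n z A j))"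
  by (simp add: wcmp_def wcomp_def)

lemma whisk_cong:
  assumes "\<And>e i. 0 < i \<Longrightarrow> i \<le> j \<Longrightarrow> z e i = z' e i"
  shows "whisk C n z A j = whisk C n z' A j"
    and "whisk_defined C n z A j \<longleftrightarrow> whisk_defined C n z' A j"
proof -
  have "whisk C n z A j = whisk C n z' A j \<and>
    (whisk_defined C n z A j \<longleftrightarrow> whisk_defined C n z' A j)"
    using assms by (induction j) auto
  then show "whisk C n z A j = whisk C n z' A j"
    "whisk_defined C n z A j \<longleftrightarrow> whisk_defined C n z' A j" by auto
qed

context precategory
begin

text \<open>
  The boundaries of the whiskers of \<open>x\<close> are determined by those of \<open>x\<close>, except for the inner
  \<open>(i-1)\<close>-boundary of the \<open>i\<close>-dimensional ones.
\<close>

definition fits :: "nat \<Rightarrow> (sgn \<Rightarrow> nat \<Rightarrow> 'a) \<Rightarrow> 'a \<Rightarrow> bool" where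
  "fits m z x \<longleftrightarrow> (\<forall>e i. 0 < i \<and> i \<le> m \<longrightarrow> z e i \<in> cells C i \<and>
     (\<forall>e' j. Suc j < i \<or> Suc j = i \<and> e' = e \<longrightarrow> bds C e' j i (z e i) = bds C e' j n x))"

text \<open>The condition on \<open>i\<close> and \<open>e'\<close> is the one under which
  \<open>act\<close> changes a whisker, so every composite that \<open>act\<close> forms is
  defined.\<close>

lemma fits_wcomp:
  assumes "fits m z x" "wcomp C e (Suc j) n a x" "m < n" "i \<le> m" "Suc j < i \<or> Suc j = i \<and> e' = e"
  shows "wcomp C e (Suc j) i a (z e' i)"
proof -
  have "j < i" "j < n" "0 < i" using assms by auto
  then have "z e' i \<in> cells C i" "bds C e j i (z e' i) = bds C e j n x"
    using assms unfolding fits_def by auto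
  with \<open>j < i\<close> \<open>j < n\<close> assms(2) show ?thesis by (auto simp: wcomp_iff)
qed

lemma act_idn:
  assumes "fits m z x" "m < n" "j < n" "a \<in> cells C j" "wcomp C e (Suc j) n (idn C j a) x"
  shows "act C m e (Suc j) (idn C j a) z = z"
  using fits_wcomp[OF assms(1,5,2)] assms by (auto simp: act_def fun_eq_iff intro!: wcmp_idn_left)

lemma act_act:
  assumes "fits m z x" "m < n" "j < n" "wcomp C e (Suc j) (Suc j) a b" "wcomp C e (Suc j) n b x"
  shows "act C m e (Suc j) (wcmp C e (Suc j) (Suc j) a b) z =
    act C m e (Suc j) a (act C m e (Suc j) b z)"
  using fits_wcomp[OF assms(1,5,2)] assms
  by (auto simp: act_def fun_eq_iff intro!: wcmp_assoc)

lemma act_swap: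
  assumes "fits m z x" "m < n" "j < n" "wcomp C e (Suc j) n a x" "wcomp C e' (Suc j) n b x" "e \<noteq> e'"
  shows "act C m e (Suc j) a (act C m e' (Suc j) b z) = act C m e' (Suc j) b (act C m e (Suc j) a z)"
  using fits_wcomp[OF assms(1,4,2)] fits_wcomp[OF assms(1,5,2)] assms
  by (auto simp: act_def fun_eq_iff intro!: wcmp_swap)

text \<open>In dimension \<open>Suc i\<close> on side \<open>e'\<close> and in all higher dimensions
  up to \<open>m\<close> this is \<open>wcmp_distrib\<close>; elsewhere only \<open>a\<close> can
  act, and in the same way on both sides of the equation.\<close>

lemma act_distrib:
  assumes "fits m z x" "m < n" "j < i" "i < n" "wcomp C e' (Suc i) n b x" "wcomp C e (Suc j) n a x"
  shows "act C m e (Suc j) a (act C m e' (Suc i) b z) =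
    act C m e' (Suc i) (wcmp C e (Suc j) (Suc i) a b) (act C m e (Suc j) a z)"
  using fits_wcomp[OF assms(1,5,2)] fits_wcomp[OF assms(1,6,2)] assms
  by (auto simp: act_def fun_eq_iff intro!: wcmp_distrib)

section \<open>The whiskered composite of a family\<close>

lemma whisk_cell: "m < n \<Longrightarrow> whisk_defined C n z A m \<Longrightarrow> whisk C n z A m \<in> cells C n"
proof (induction m)
  case (Suc m)
  then show ?case
    unfolding whisk_defined_Suc whisk_Suc by (auto intro!: wcmp_cell)
qed simp

lemma bds_whisk_Suc:
  assumes "m < n" "whisk_defined C n z A (Suc m)" "j < m"
  shows "bds C e j n (whisk C n z A (Suc m)) = bds C e j n (whisk C n z A m)"
  using assms unfolding whisk_defined_Suc whisk_Suc
  by (simp add: bds_wcmp_below)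

text \<open>Adding the whiskers of dimension \<open>Suc m\<close> keeps the boundaries below
  dimension \<open>m\<close> and replaces those of dimension \<open>m\<close> by the outer
  boundaries of the new whiskers.\<close>

lemma whisk_fits: "m < n \<Longrightarrow> whisk_defined C n z A m \<Longrightarrow> fits m z (whisk C n z A m)"
proof (induction m)
  case (Suc m)
  let ?X = "whisk C n z A m" and ?X' = "whisk C n z A (Suc m)"
  let ?Y = "wcmp C Minus (Suc m) n (z Minus (Suc m)) ?X"
  have m: "m < n" using Suc.prems by simp
  have c: "wcomp C Minus (Suc m) n (z Minus (Suc m)) ?X" "wcomp C Plus (Suc m) n (z Plus (Suc m)) ?Y"
    using Suc.prems unfolding whisk_defined_Suc by auto
  have cell: "z e (Suc m) \<in> cells C (Suc m)" for e
    using c m by (cases e) (auto simp: wcomp_iff)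
  have IH: "fits m z ?X" using Suc unfolding whisk_defined_Suc by simp
  have low: "bds C e j n ?X' = bds C e j n ?X" if "j < m" for e j
    using bds_whisk_Suc[OF m Suc.prems(2) that] .
  have lowY: "bds C e j n ?Y = bds C e j n ?X" if "j < m" for e j
    using c m that by (simp add: bds_wcmp_below)
  have below: "bds C e' j (Suc m) (z e (Suc m)) = bds C e' j n ?X'" if "j < m" for e e' j
    using wcomp_bds_eq[OF that m _ c(1), of e'] wcomp_bds_eq[OF that m _ c(2), of e']
      low[OF that, of e'] lowY[OF that, of e']
    by (cases e) auto
  have top: "bd C e m (z e (Suc m)) = bds C e m n ?X'" for e
    using c m unfolding whisk_Suc by (cases e) (simp_all add: bds_wcmp_same bds_wcmp_below)
  show ?case
    unfolding fits_def
  proof (intro allI impI conjI; elim conjE)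
    fix e :: sgn and i assume i: "0 < i" "i \<le> Suc m"
    show "z e i \<in> cells C i"
      using IH cell i by (cases "i = Suc m") (auto simp: fits_def)
  next
    fix e e' :: sgn and i j assume i: "0 < i" "i \<le> Suc m" and j: "Suc j < i \<or> Suc j = i \<and> e' = e"
    show "bds C e' j i (z e i) = bds C e' j n ?X'"
    proof (cases "i = Suc m")
      case True
      then show ?thesis using j below top by (cases "j = m") auto
    next
      case False
      then have "i \<le> m" "j < m" using i j by auto
      then show ?thesis using IH i j low unfolding fits_def by auto
    qed
  qed
qed (simp add: fits_def)

text \<open>This justifies \<open>act\<close>. Peeling off the outermost whiskers, \<open>a\<close>
  passes those of dimension above \<open>Suc j\<close> by distributivity and is absorbed in
  dimension \<open>Suc j\<close> by associativity. The bound \<open>M\<close> of \<open>act\<close>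
  stays fixed while \<open>m\<close> varies in the induction.\<close>

lemma whisk_act:
  assumes "m < n" "m \<le> M" "j < m" "whisk_defined C n z A m" "wcomp C e (Suc j) n a (whisk C n z A m)"
  shows "whisk_defined C n (act C M e (Suc j) a z) A m \<and>
    whisk C n (act C M e (Suc j) a z) A m = wcmp C e (Suc j) n a (whisk C n z A m)"
  using assms
proof (induction m)
  case (Suc m)
  let ?z = "act C M e (Suc j) a z"
  let ?X = "whisk C n z A m" and ?X' = "whisk C n z A (Suc m)"
  let ?l = "z Minus (Suc m)" and ?r = "z Plus (Suc m)"
  let ?Y = "wcmp C Minus (Suc m) n ?l ?X"
  have m: "m < n" and M: "Suc m \<le> M" using Suc.prems by auto
  have d: "whisk_defined C n z A m"
    and c: "wcomp C Minus (Suc m) n ?l ?X" "wcomp C Plus (Suc m) n ?r ?Y"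
    using Suc.prems(4) unfolding whisk_defined_Suc by auto
  have X': "?X' = wcmp C Plus (Suc m) n ?r ?Y" by (rule whisk_Suc)
  show ?case
  proof (cases "j = m")
    case True
    \<comment> \<open>\<open>act\<close> leaves the whiskers of dimension up to \<open>m\<close>
      alone, so the inner composite does not change.\<close>
    have z: "whisk_defined C n ?z A m" "whisk C n ?z A m = ?X"
      using whisk_cong[of m ?z z C n A] d True by (auto simp: act_def)
    show ?thesis
    proof (cases e)
      case Plus
      have z': "?z Minus (Suc m) = ?l" "?z Plus (Suc m) = wcmp C Plus (Suc m) (Suc m) a ?r"
        using True Plus M by (auto simp: act_def)
      have ar: "wcomp C Plus (Suc m) (Suc m) a ?r"
        using Suc.prems(5) c(2) m True Plus unfolding X' by (simp add: wcomp_iff bds_wcmp_same)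
      show ?thesis
        unfolding whisk_defined_Suc whisk_Suc[of C n ?z] z z'
        using X' z(1) c True Plus m wcomp_wcmp(1)[OF m _ ar c(2)] wcmp_assoc[OF m _ ar c(2)] by simp
    next
      case Minus
      have z': "?z Minus (Suc m) = wcmp C Minus (Suc m) (Suc m) a ?l" "?z Plus (Suc m) = ?r"
        using True Minus M by (auto simp: act_def)
      \<comment> \<open>The right whisker is applied last, so \<open>a\<close> has to be swapped
        with it before the left whisker can absorb it.\<close>
      have aY: "wcomp C Minus (Suc m) n a ?Y"
        using Suc.prems(5) c m True Minus wcmp_cell[OF m _ c(1)] unfolding X'
        by (simp add: wcomp_iff bds_wcmp_below)
      have al: "wcomp C Minus (Suc m) (Suc m) a ?l"
        using aY c(1) m by (simp add: wcomp_iff bds_wcmp_same)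
      show ?thesis
        unfolding whisk_defined_Suc whisk_Suc[of C n ?z] z z'
        using X' z(1) c True Minus m wcomp_wcmp(1)[OF m _ al c(1)] wcmp_assoc[OF m _ al c(1)]
          wcomp_swap[OF m _ c(2) aY] wcmp_swap[OF m _ c(2) aY] by simp
    qed
  next
    case False
    then have j: "j < m" using Suc.prems by simp
    have z': "?z e' (Suc m) = wcmp C e (Suc j) (Suc m) a (z e' (Suc m))" for e'
      using j M by (auto simp: act_def)
    \<comment> \<open>\<open>a\<close> passes the right whisker, then the left one, and the
      induction hypothesis takes over.\<close>
    have aY: "wcomp C e (Suc j) n a ?Y"
      using Suc.prems(5) c m j wcmp_cell[OF m _ c(1)] unfolding X'
      by (simp add: wcomp_iff bds_wcmp_below)
    have aX: "wcomp C e (Suc j) n a ?X"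
      using aY c m j by (simp add: wcomp_iff bds_wcmp_below)
    have z: "whisk_defined C n ?z A m" "whisk C n ?z A m = wcmp C e (Suc j) n a ?X"
      using Suc.IH m M j d aX by auto
    show ?thesis
      unfolding whisk_defined_Suc whisk_Suc[of C n ?z] z z' X'
      using z(1) wcomp_distrib(3)[OF j m _ c(1) aX] wcmp_distrib[OF j m _ c(1) aX]
        wcomp_distrib(3)[OF j m _ c(2) aY] wcmp_distrib[OF j m _ c(2) aY] by simp
  qed
qed simp

section \<open>Whiskers that are identities\<close>

lemma wcomp_bds:
  assumes "wcomp C e (Suc j) n a x" "j < i" "i \<le> n"
  shows "wcomp C e (Suc j) i a (bds C e' i n x)"
  using assms bds_cell[of i n x e'] bds_bds[of j i n x e e'] by (simp add: wcomp_iff)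

lemma wcomp_idn:
  assumes "wcomp C e (Suc j) i a x" "j < i" "i < n"
  shows "wcomp C e (Suc j) (Suc i) a (idn C i x)"
  using assms idn_cell[of i x] by (simp add: wcomp_iff bd_idn)

text \<open>Above its own dimension, a whisker turns the identity fillers of \<open>x\<close> into
  those of the whiskered cell.\<close>

lemma wcmp_idn_bds:
  assumes "wcomp C e (Suc j) n a x" "j < i" "i < n"
  shows "wcmp C e (Suc j) (Suc i) a (idn C i (bds C e' i n x)) =
    idn C i (bds C e' i n (wcmp C e (Suc j) n a x))"
proof -
  have c: "wcomp C e (Suc j) i a (bds C e' i n x)" using wcomp_bds assms by simp
  then have "bds C e' i n x \<in> cells C i" using assms by (simp add: wcomp_iff)
  then have "wcmp C e (Suc j) (Suc i) a (idn C i (bds C e' i n x)) =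
    idn C i (wcmp C e (Suc j) i a (bds C e' i n x))"
    using assms wcomp_idn[OF c] by (intro wcmp_idn_right)
  then show ?thesis using assms by (simp add: bds_wcmp_above)
qed

text \<open>In its own dimension, a whisker takes the place of the identity filler.\<close>

lemma wcmp_idn_bds_same:
  assumes "wcomp C e (Suc j) n a x" "j < n"
  shows "wcmp C e (Suc j) (Suc j) a (idn C j (bds C e j n x)) = a"
  using assms bds_cell[of j n x e] idn_cell[of j "bds C e j n x"]
  by (intro wcmp_idn_same) (auto simp: wcomp_iff bd_idn)

text \<open>Acting with the next pair of whiskers replaces the identities of dimension
  \<open>Suc j\<close> by that pair and carries the higher ones to identities on the boundaries of
  the new composite. This is the inductive step for reading whiskers back from a cell.\<close>

lemma fill_Suc:
  assumes "m < n" "j < m" "whisk_defined C n z A (Suc j)"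
  shows "fill C n m z (Suc j) (whisk C n z A (Suc j)) =
    act C m Plus (Suc j) (z Plus (Suc j)) (act C m Minus (Suc j) (z Minus (Suc j))
      (fill C n m z j (whisk C n z A j)))"
proof (intro ext)
  fix e i
  let ?X = "whisk C n z A j" and ?X' = "whisk C n z A (Suc j)"
  let ?l = "z Minus (Suc j)" and ?r = "z Plus (Suc j)"
  let ?Y = "wcmp C Minus (Suc j) n ?l ?X"
  have c: "wcomp C Minus (Suc j) n ?l ?X" "wcomp C Plus (Suc j) n ?r ?Y"
    using assms(3) unfolding whisk_defined_Suc by auto
  have X': "?X' = wcmp C Plus (Suc j) n ?r ?Y" by (rule whisk_Suc)
  have j: "j < n" using assms by simp
  \<comment> \<open>The right filler is an identity on the target of \<open>?X\<close>, whereas the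
    right whisker is composable with \<open>?Y\<close>; the left whisker does not affect this
    target.\<close>
  have Y: "bds C Plus j n ?Y = bds C Plus j n ?X"
    using c j by (simp add: bds_wcmp_below)
  consider "i \<le> j \<or> m < i" | "i = Suc j" | i' where "i = Suc i'" "j < i'" "i' < m"
    using assms(2) by (cases i) (auto simp: less_Suc_eq_le not_le, force)
  then show "fill C n m z (Suc j) ?X' e i =
    act C m Plus (Suc j) ?r (act C m Minus (Suc j) ?l (fill C n m z j ?X)) e i"
  proof cases
    case 2
    then show ?thesis
      using wcmp_idn_bds_same[OF c(1) j] wcmp_idn_bds_same[OF c(2) j] assms Y
      by (cases e) (auto simp: fill_def act_def)
  next
    case 3
    then show ?thesis
      using wcmp_idn_bds[OF c(1), of i' e] wcmp_idn_bds[OF c(2), of i' e] assms X'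
      by (auto simp: fill_def act_def)
  qed (auto simp: fill_def act_def)
qed

lemma whisk_fill_0:
  assumes "A \<in> cells C n" "m < n" "m \<le> M"
  shows "whisk_defined C n (fill C n M z 0 A) A m \<and> whisk C n (fill C n M z 0 A) A m = A"
  using assms
proof (induction m)
  case (Suc m)
  have m: "m < n" using Suc.prems by simp
  let ?z = "fill C n M z 0 A"
  have z: "?z e (Suc m) = idn C m (bds C e m n A)" for e
    using Suc.prems by (simp add: fill_def)
  have cell: "bds C e m n A \<in> cells C m" for e using Suc.prems by (simp add: bds_cell)
  have c: "wcomp C e (Suc m) n (?z e (Suc m)) A" for e
    using m cell[of e] Suc.prems by (simp add: z wcomp_iff idn_cell bd_idn)
  have "wcmp C e (Suc m) n (?z e (Suc m)) A = A" for e
    using c[of e] cell[of e] m unfolding z by (intro wcmp_idn_left) auto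
  then show ?case
    using Suc c unfolding whisk_defined_Suc whisk_Suc by simp
qed simp

end


section \<open>Composites of lists\<close>

text \<open>The composite is built on an identity, so the empty list needs no separate treatment;
  since that identity is arbitrary there, this is a relation. \<open>comps_composite\<close>
  compares it with \<open>composite\<close> on nonempty lists.\<close>

inductive comps :: "'a precat \<Rightarrow> nat \<Rightarrow> 'a list \<Rightarrow> 'a \<Rightarrow> bool" for C p where
  nil: "a \<in> cells C p \<Longrightarrow> comps C p [] (idn C p a)"
| cons: "comps C p us v \<Longrightarrow> composable C (Suc p) (Suc p) u v \<Longrightarrow>
    comps C p (u # us) (cmp C (Suc p) (Suc p) u v)"

lemma composable_same_iff:
  "composable C (Suc p) (Suc p) u v \<longleftrightarrow>
    u \<in> cells C (Suc p) \<and> v \<in> cells C (Suc p) \<and> bd C Plus p u = bd C Minus p v"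
  by (auto simp: composable_def)

context precategory
begin

lemma comps_cell:
  assumes "comps C p us u" "p < n"
  shows "u \<in> cells C (Suc p)"
  using assms by cases (auto intro: idn_cell cmp_cell[of "Suc p" "Suc p", simplified])

lemma comps_append:
  assumes "comps C p us u" "p < n" "comps C p vs v" "composable C (Suc p) (Suc p) u v"
  shows "comps C p (us @ vs) (cmp C (Suc p) (Suc p) u v)"
  using assms
proof (induction rule: comps.induct)
  case (nil a)
  then show ?case by (simp add: idn_cmp_le)
next
  case (cons us u' u)
  have c: "composable C (Suc p) (Suc p) u' v"
    using cons comps_cell[OF cons.hyps(1)] by (simp add: composable_same_iff bd_cmp_Plus)
  have "cmp C (Suc p) (Suc p) u' v \<in> cells C (Suc p)"
    using cons c cmp_cell[of "Suc p" "Suc p" u' v] by simp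
  then have c': "composable C (Suc p) (Suc p) u (cmp C (Suc p) (Suc p) u' v)"
    using cons c by (simp add: composable_same_iff bd_cmp_Minus)
  have "cmp C (Suc p) (Suc p) (cmp C (Suc p) (Suc p) u u') v =
    cmp C (Suc p) (Suc p) u (cmp C (Suc p) (Suc p) u' v)"
    using cons c c' cmp_assoc[of "Suc p" "Suc p" "Suc p" p u u' v] by simp
  then show ?case using cons c c' by (simp add: comps.cons)
qed

lemma comps_single:
  assumes "p < n" "u \<in> cells C (Suc p)"
  shows "comps C p [u] u"
proof -
  have a: "bd C Plus p u \<in> cells C p" using assms by (simp add: bd_cell)
  then have c: "composable C (Suc p) (Suc p) u (idn C p (bd C Plus p u))"
    using assms by (simp add: composable_same_iff idn_cell bd_idn)
  show ?thesis
    using comps.cons[OF comps.nil[OF a] c] cmp_idn_le[of "Suc p" p "bd C Plus p u" u] a c assms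
    by simp
qed

lemma comps_wcmp:
  assumes "comps C p us u" "p < n" "j < p" "wcomp C e (Suc j) (Suc p) a u"
  shows "comps C p (map (wcmp C e (Suc j) (Suc p) a) us) (wcmp C e (Suc j) (Suc p) a u)"
  using assms
proof (induction rule: comps.induct)
  case (nil b)
  then have "wcomp C e (Suc j) p a b" by (simp add: wcomp_iff bd_idn)
  then have "wcmp C e (Suc j) p a b \<in> cells C p" using nil by (intro wcmp_cell) auto
  then show ?case using nil by (simp add: wcmp_idn_right comps.nil)
next
  case (cons us v u)
  \<comment> \<open>Composition along dimension \<open>p\<close> is regarded as left whiskering of
    \<open>v\<close> with \<open>u\<close>, so that \<open>wcmp_distrib\<close> applies to
    it.\<close>
  have uv: "wcomp C Minus (Suc p) (Suc p) u v"
    and cmp: "\<And>x y. cmp C (Suc p) (Suc p) x y = wcmp C Minus (Suc p) (Suc p) x y"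
    using cons by (simp_all add: wcomp_def wcmp_def)
  have av: "wcomp C e (Suc j) (Suc p) a v"
    using cons uv bds_wcmp_below[of p "Suc p" Minus u v j e]
    unfolding cmp by (simp add: wcomp_iff composable_same_iff)
  have "wcomp C Minus (Suc p) (Suc p) (wcmp C e (Suc j) (Suc p) a u) (wcmp C e (Suc j) (Suc p) a v)"
    using wcomp_distrib(3)[OF _ _ _ uv av] cons by simp
  moreover have "wcmp C e (Suc j) (Suc p) a (cmp C (Suc p) (Suc p) u v) =
    cmp C (Suc p) (Suc p) (wcmp C e (Suc j) (Suc p) a u) (wcmp C e (Suc j) (Suc p) a v)"
    using wcmp_distrib[OF _ _ _ uv av] cons unfolding cmp by simp
  ultimately show ?case
    using cons av by (simp add: comps.cons wcomp_def)
qed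

text \<open>Composable factors agree in all boundaries below dimension \<open>p\<close>. Hence a
  lower-dimensional cell that can whisker the composite can whisker each factor.\<close>

lemma comps_bds:
  assumes "comps C p us u" "p < n" "j < p" "x \<in> set us"
  shows "x \<in> cells C (Suc p) \<and> bds C e j (Suc p) x = bds C e j (Suc p) u"
  using assms
proof (induction rule: comps.induct)
  case (cons us v u)
  have uv: "wcomp C Minus (Suc p) (Suc p) u v" using cons by (simp add: wcomp_def)
  have "bds C e j (Suc p) (wcmp C Minus (Suc p) (Suc p) u v) = bds C e j (Suc p) v"
    using cons uv by (intro bds_wcmp_below) auto
  moreover have "bds C e j (Suc p) u = bds C e j (Suc p) v"
    using cons uv by (intro wcomp_bds_eq) auto
  ultimately show ?case using cons by (auto simp: wcmp_def composable_same_iff)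
qed simp

lemma comps_Cons_bd:
  assumes "comps C p (u # us) v" "p < n"
  shows "u \<in> cells C (Suc p) \<and> bd C Minus p v = bd C Minus p u"
  using assms(1) by cases (use assms(2) in \<open>auto simp: composable_same_iff bd_cmp_Minus\<close>)

lemma comps_composite:
  assumes "p < n" "us \<noteq> []"
  shows "comps C p us u \<longleftrightarrow> set us \<subseteq> cells C (Suc p) \<and>
    successively (composable C (Suc p) (Suc p)) us \<and> u = composite C (Suc p) us"
  using assms
proof (induction us arbitrary: u rule: induct_list012)
  case (2 x)
  have "u = x" "x \<in> cells C (Suc p)" if "comps C p [x] u"
  proof -
    from that obtain a where a: "a \<in> cells C p" "composable C (Suc p) (Suc p) x (idn C p a)"
      and u: "u = cmp C (Suc p) (Suc p) x (idn C p a)"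
      by (auto elim: comps.cases)
    then show "u = x" "x \<in> cells C (Suc p)"
      using assms cmp_idn_le[of "Suc p" p a x] by (auto simp: composable_same_iff)
  qed
  then show ?case using comps_single 2 by auto
next
  case (3 x y us)
  let ?c = "composite C (Suc p) (y # us)"
  have IH: "comps C p (y # us) v \<longleftrightarrow> set (y # us) \<subseteq> cells C (Suc p) \<and>
    successively (composable C (Suc p) (Suc p)) (y # us) \<and> v = ?c" for v
    using 3 by blast
  \<comment> \<open>Both sides only involve the source of the tail, which is the source of its first
    factor.\<close>
  have step: "composable C (Suc p) (Suc p) x ?c \<longleftrightarrow> composable C (Suc p) (Suc p) x y"
    if "comps C p (y # us) ?c"
    using comps_Cons_bd[OF that] comps_cell[OF that] assms by (auto simp: composable_same_iff)
  show ?case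
  proof
    assume "comps C p (x # y # us) u"
    then obtain v where v: "comps C p (y # us) v" "composable C (Suc p) (Suc p) x v"
      "u = cmp C (Suc p) (Suc p) x v" by (auto elim: comps.cases)
    then have "v = ?c" using IH by blast
    then show "set (x # y # us) \<subseteq> cells C (Suc p) \<and>
      successively (composable C (Suc p) (Suc p)) (x # y # us) \<and>
      u = composite C (Suc p) (x # y # us)"
      using v IH[of v] step by (auto simp: composable_same_iff)
  next
    assume r: "set (x # y # us) \<subseteq> cells C (Suc p) \<and>
      successively (composable C (Suc p) (Suc p)) (x # y # us) \<and>
      u = composite C (Suc p) (x # y # us)"
    then have c: "comps C p (y # us) ?c" using IH by auto
    then show "comps C p (x # y # us) u" using r step comps.cons[OF c, of x] by simp
  qed
qed simp

end

lemma fill_0_cong: "fill C n m z 0 x = fill C n m z' 0 x"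
  by (auto simp: fill_def fun_eq_iff)

lemma fill_fill: "fill C n m z m x = (\<lambda>e i. if i = 0 \<or> m < i then undefined else z e i)"
  by (auto simp: fill_def fun_eq_iff)

section \<open>The normal form of a cell\<close>

sublocale precategory_plus \<subseteq> F: precategory "Suc n" "free_precat n C"
  by (rule precategory_free)

context precategory_plus
begin

abbreviation gen :: "'a \<Rightarrow> 'a fcell" where
  "gen A \<equiv> New (cl (Gen A))"

text \<open>The whiskers are stored as cells of \<open>F\<close>, so that the lemmas on families
  apply in the single precategory \<open>F\<close>; the generator is kept as an element of
  \<open>C\<close>, so that \<open>A\<close> itself can be recovered and not only its class. At
  level \<open>0\<close>, \<open>fill\<close> ignores its family, and \<open>undefined\<close> is a
  placeholder (\<open>fill_0_cong\<close>).\<close>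

primrec nf :: "'a pterm \<Rightarrow> ((sgn \<Rightarrow> nat \<Rightarrow> 'a fcell) \<times> 'a) list" where
  "nf (Gen A) = [(fill F (Suc n) n undefined 0 (gen A), A)]"
| "nf (Ident a) = []"
| "nf (LWhisk k a t) = map (apfst (act F n Minus k (Old a))) (nf t)"
| "nf (RWhisk k t a) = map (apfst (act F n Plus k (Old a))) (nf t)"
| "nf (Comp s t) = nf s @ nf t"

abbreviation val :: "(sgn \<Rightarrow> nat \<Rightarrow> 'a fcell) \<times> 'a \<Rightarrow> 'a fcell" where
  "val d \<equiv> whisk F (Suc n) (fst d) (gen (snd d)) n"

definition valid :: "(sgn \<Rightarrow> nat \<Rightarrow> 'a fcell) \<times> 'a \<Rightarrow> bool" where
  "valid d \<longleftrightarrow> snd d \<in> cells C (Suc n) \<and> whisk_defined F (Suc n) (fst d) (gen (snd d)) n"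

lemma valid_act:
  assumes "valid d" "j < n" "wcomp F e (Suc j) (Suc n) a (val d)"
  shows "valid (apfst (act F n e (Suc j) a) d)"
    and "val (apfst (act F n e (Suc j) a) d) = wcmp F e (Suc j) (Suc n) a (val d)"
  using assms F.whisk_act[of n n j "fst d" "gen (snd d)" e a] by (auto simp: valid_def)

lemma wcomp_comps:
  assumes "comps F n us u" "x \<in> set us" "j < n" "wcomp F e (Suc j) (Suc n) a u"
  shows "wcomp F e (Suc j) (Suc n) a x"
  using assms F.comps_bds[OF assms(1) _ assms(3,2), of e] by (simp add: wcomp_iff)

text \<open>\<open>whisk_act\<close> for each factor, combined with distributivity over the
  composite.\<close>

lemma comps_act:
  assumes "\<forall>d\<in>set ds. valid d" "comps F n (map val ds) u" "j < n" "wcomp F e (Suc j) (Suc n) a u"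
  shows "(\<forall>d\<in>set (map (apfst (act F n e (Suc j) a)) ds). valid d) \<and>
    comps F n (map val (map (apfst (act F n e (Suc j) a)) ds)) (wcmp F e (Suc j) (Suc n) a u)"
proof -
  have c: "wcomp F e (Suc j) (Suc n) a (val d)" if "d \<in> set ds" for d
    using wcomp_comps[OF assms(2) _ assms(3,4)] that by simp
  have v: "map val (map (apfst (act F n e (Suc j) a)) ds) =
    map (wcmp F e (Suc j) (Suc n) a) (map val ds)"
    using valid_act(2) assms(1,3) c by (auto simp del: fst_apfst snd_apfst)
  have "valid (apfst (act F n e (Suc j) a) d)" if "d \<in> set ds" for d
    using valid_act(1)[OF _ assms(3) c] assms(1) that by blast
  then show ?thesis
    unfolding v using F.comps_wcmp[OF assms(2) _ assms(3,4)] by auto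
qed

text \<open>Composability forces \<open>0 < k\<close>, so \<open>k\<close> is some
  \<open>Suc j\<close>; this turns the term constructor into whiskering in \<open>F\<close>.\<close>

lemma wft_LWhiskE:
  assumes "wft (LWhisk k a t)"
  obtains j where "k = Suc j" "j < n" "wft t" "wcomp F Minus (Suc j) (Suc n) (Old a) (New (cl t))"
    "wcmp F Minus (Suc j) (Suc n) (Old a) (New (cl t)) = New (cl (LWhisk k a t))"
proof -
  have "0 < k" "k \<le> n" "wft t" using assms by (auto simp: composable_def)
  then show thesis
    using assms by (intro that[of "k - 1"]) (auto simp: wcomp_def wcmp_def simp del: wf_term.simps)
qed

lemma wft_RWhiskE:
  assumes "wft (RWhisk k t a)"
  obtains j where "k = Suc j" "j < n" "wft t" "wcomp F Plus (Suc j) (Suc n) (Old a) (New (cl t))"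
    "wcmp F Plus (Suc j) (Suc n) (Old a) (New (cl t)) = New (cl (RWhisk k t a))"
proof -
  have "0 < k" "k \<le> n" "wft t" using assms by (auto simp: composable_def)
  then show thesis
    using assms by (intro that[of "k - 1"]) (auto simp: wcomp_def wcmp_def simp del: wf_term.simps)
qed

lemma wcmp_Old:
  "wcmp F Minus k l (Old a) (Old b) = Old (cmp C k l a b)"
  "wcmp F Plus k l (Old a) (Old b) = Old (cmp C l k b a)"
  by (simp_all add: wcmp_def)

text \<open>Each term constructor is matched by an operation on lists: \<open>Gen\<close> by
  identity whiskers, whiskering by \<open>comps_act\<close>, \<open>Comp\<close> by
  \<open>comps_append\<close>. Existence of decompositions rests on this.\<close>

lemma nf_comps: "wft t \<Longrightarrow> (\<forall>d\<in>set (nf t). valid d) \<and> comps F n (map val (nf t)) (New (cl t))"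
proof (induction t)
  case (Gen A)
  then show ?case
    using F.whisk_fill_0[of "gen A" n n undefined] F.comps_single[of n "gen A"]
    by (auto simp: valid_def)
next
  case (Ident a)
  then show ?case using comps.nil[of "Old a" F n] by simp
next
  case (LWhisk k a t)
  from LWhisk.prems obtain j where j: "k = Suc j" "j < n" "wft t"
    "wcomp F Minus (Suc j) (Suc n) (Old a) (New (cl t))"
    "wcmp F Minus (Suc j) (Suc n) (Old a) (New (cl t)) = New (cl (LWhisk k a t))"
    by (rule wft_LWhiskE)
  show ?case
    using comps_act[OF conjunct1 conjunct2 j(2,4), OF LWhisk.IH LWhisk.IH, OF j(3) j(3)]
    unfolding nf.simps j(5) unfolding j(1) .
next
  case (RWhisk k t a)
  from RWhisk.prems obtain j where j: "k = Suc j" "j < n" "wft t"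
    "wcomp F Plus (Suc j) (Suc n) (Old a) (New (cl t))"
    "wcmp F Plus (Suc j) (Suc n) (Old a) (New (cl t)) = New (cl (RWhisk k t a))"
    by (rule wft_RWhiskE)
  show ?case
    using comps_act[OF conjunct1 conjunct2 j(2,4), OF RWhisk.IH RWhisk.IH, OF j(3) j(3)]
    unfolding nf.simps j(5) unfolding j(1) .
next
  case (Comp s t)
  then have w: "wft s" "wft t" by simp_all
  then have "composable F (Suc n) (Suc n) (New (cl s)) (New (cl t))" using Comp.prems by simp
  from F.comps_append[OF conjunct2[OF Comp.IH(1)[OF w(1)]] _ conjunct2[OF Comp.IH(2)[OF w(2)]] this]
  have "comps F n (map val (nf (Comp s t))) (New (cl (Comp s t)))"
    unfolding F_cmp(4)[OF Comp.prems] nf.simps map_append by simp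
  then show ?case using Comp.IH w by auto
qed

section \<open>Invariance of the normal form under the axioms\<close>

lemma nf_fits:
  assumes "wft t" "d \<in> set (nf t)"
  obtains x where "F.fits n (fst d) x"
    "\<And>e j a. j < n \<Longrightarrow> wcomp F e (Suc j) (Suc n) a (New (cl t)) \<Longrightarrow> wcomp F e (Suc j) (Suc n) a x"
proof
  \<comment> \<open>The witness is the factor itself: its family fits it, and it accepts the same
    lower-dimensional whiskers as the whole composite.\<close>
  show "F.fits n (fst d) (val d)"
    using nf_comps[OF assms(1)] assms(2) F.whisk_fits[of n] by (auto simp: valid_def)
  show "wcomp F e (Suc j) (Suc n) a (val d)"
    if "j < n" "wcomp F e (Suc j) (Suc n) a (New (cl t))" for e j a
    using nf_comps[OF assms(1)] assms(2) that wcomp_comps by auto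
qed

lemma nf_act_idn:
  assumes "wft t" "j < n" "a \<in> cells C j" "wcomp F e (Suc j) (Suc n) (Old (idn C j a)) (New (cl t))"
  shows "map (apfst (act F n e (Suc j) (Old (idn C j a)))) (nf t) = nf t"
proof (rule map_idI)
  fix d assume "d \<in> set (nf t)"
  with nf_fits[OF assms(1)] obtain x where "F.fits n (fst d) x"
    "wcomp F e (Suc j) (Suc n) (Old (idn C j a)) x" using assms by metis
  then show "apfst (act F n e (Suc j) (Old (idn C j a))) d = d"
    using F.act_idn[of n "fst d" x j "Old a" e] assms by (cases d) simp
qed

lemma nf_act_act:
  assumes "wft t" "j < n" "wcomp F e (Suc j) (Suc j) a b" "wcomp F e (Suc j) (Suc n) b (New (cl t))"
  shows "map (apfst (act F n e (Suc j) (wcmp F e (Suc j) (Suc j) a b))) (nf t) =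
    map (apfst (act F n e (Suc j) a)) (map (apfst (act F n e (Suc j) b)) (nf t))"
  unfolding map_map
proof (rule map_cong[OF HOL.refl])
  fix d assume "d \<in> set (nf t)"
  with nf_fits[OF assms(1)] obtain x where "F.fits n (fst d) x"
    "wcomp F e (Suc j) (Suc n) b x" using assms by metis
  then show "apfst (act F n e (Suc j) (wcmp F e (Suc j) (Suc j) a b)) d =
    (apfst (act F n e (Suc j) a) \<circ> apfst (act F n e (Suc j) b)) d"
    using F.act_act[of n "fst d" x j e a b] assms by (cases d) simp
qed

lemma nf_act_swap:
  assumes "wft t" "j < n" "wcomp F e (Suc j) (Suc n) a (New (cl t))"
    "wcomp F e' (Suc j) (Suc n) b (New (cl t))" "e \<noteq> e'"
  shows "map (apfst (act F n e (Suc j) a)) (map (apfst (act F n e' (Suc j) b)) (nf t)) =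
    map (apfst (act F n e' (Suc j) b)) (map (apfst (act F n e (Suc j) a)) (nf t))"
  unfolding map_map
proof (rule map_cong[OF HOL.refl])
  fix d assume "d \<in> set (nf t)"
  with nf_fits[OF assms(1)] obtain x where "F.fits n (fst d) x"
    "wcomp F e (Suc j) (Suc n) a x" "wcomp F e' (Suc j) (Suc n) b x" using assms by metis
  then show "(apfst (act F n e (Suc j) a) \<circ> apfst (act F n e' (Suc j) b)) d =
    (apfst (act F n e' (Suc j) b) \<circ> apfst (act F n e (Suc j) a)) d"
    using F.act_swap[of n "fst d" x j e a e' b] assms by (cases d) simp
qed

lemma nf_act_distrib:
  assumes "wft t" "j < i" "i < n" "wcomp F e' (Suc i) (Suc n) b (New (cl t))"
    "wcomp F e (Suc j) (Suc n) a (New (cl t))"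
  shows "map (apfst (act F n e (Suc j) a)) (map (apfst (act F n e' (Suc i) b)) (nf t)) =
    map (apfst (act F n e' (Suc i) (wcmp F e (Suc j) (Suc i) a b)))
      (map (apfst (act F n e (Suc j) a)) (nf t))"
  unfolding map_map
proof (rule map_cong[OF HOL.refl])
  fix d assume "d \<in> set (nf t)"
  with nf_fits[OF assms(1)] obtain x where "F.fits n (fst d) x"
    "wcomp F e (Suc j) (Suc n) a x" "wcomp F e' (Suc i) (Suc n) b x"
    using assms by (metis less_trans)
  then show "(apfst (act F n e (Suc j) a) \<circ> apfst (act F n e' (Suc i) b)) d =
    (apfst (act F n e' (Suc i) (wcmp F e (Suc j) (Suc i) a b)) \<circ> apfst (act F n e (Suc j) a)) d"
    using F.act_distrib[of n "fst d" x j i e' b e a] assms by (cases d) simp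
qed

text \<open>The axioms on whiskers become the laws of \<open>act\<close>. Those in which
  \<open>Comp\<close> occurs, or in which \<open>Ident\<close> is whiskered, become identities
  between lists and are left to the simplifier.\<close>

lemma term_ax_nf:
  assumes "term_ax n C s t" "wft s" "wft t"
  shows "nf s = nf t"
  using assms
proof (cases rule: term_ax.cases)
  case (lwhisk_idn j a)
  then have "wft (LWhisk (Suc j) (idn C j a) t)" using assms by simp
  then have "wcomp F Minus (Suc j) (Suc n) (Old (idn C j a)) (New (cl t))"
    by (rule wft_LWhiskE) simp
  then show ?thesis
    using lwhisk_idn assms nf_act_idn[of t j a Minus] by simp
next
  case (rwhisk_idn j a)
  then have "wft (RWhisk (Suc j) t (idn C j a))" using assms by simp
  then have "wcomp F Plus (Suc j) (Suc n) (Old (idn C j a)) (New (cl t))"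
    by (rule wft_RWhiskE) simp
  then show ?thesis
    using rwhisk_idn assms nf_act_idn[of t j a Plus] by simp
next
  case (lwhisk_cmp k a b r)
  then have "wft (LWhisk k b r)" using assms by simp
  then obtain j where j: "k = Suc j" "j < n" "wft r"
    "wcomp F Minus (Suc j) (Suc n) (Old b) (New (cl r))"
    by (rule wft_LWhiskE)
  then have "wcomp F Minus (Suc j) (Suc j) (Old a) (Old b)"
    using lwhisk_cmp by (simp add: wcomp_def)
  from nf_act_act[OF j(3,2) this j(4)] show ?thesis
    unfolding lwhisk_cmp(1,2) nf.simps j(1) wcmp_Old .
next
  case (rwhisk_cmp k a b r)
  then have "wft (RWhisk k r a)" using assms by simp
  then obtain j where j: "k = Suc j" "j < n" "wft r"
    "wcomp F Plus (Suc j) (Suc n) (Old a) (New (cl r))"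
    by (rule wft_RWhiskE)
  \<comment> \<open>On the right, \<open>b\<close> is the outer whisker, so \<open>a\<close> and
    \<open>b\<close> exchange roles.\<close>
  then have "wcomp F Plus (Suc j) (Suc j) (Old b) (Old a)"
    using rwhisk_cmp by (simp add: wcomp_def)
  from nf_act_act[OF j(3,2) this j(4)] show ?thesis
    unfolding rwhisk_cmp(1,2) nf.simps j(1) wcmp_Old by (rule HOL.sym)
next
  case (whisk_assoc k a r b)
  then have w: "wft (LWhisk k a r)" "wft (RWhisk k r b)" using assms by simp_all
  from w(1) obtain j where j: "k = Suc j" "j < n" "wft r"
    "wcomp F Minus (Suc j) (Suc n) (Old a) (New (cl r))"
    by (rule wft_LWhiskE)
  from w(2) have "wcomp F Plus (Suc j) (Suc n) (Old b) (New (cl r))"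
    by (rule wft_RWhiskE) (use j in simp)
  from nf_act_swap[OF j(3,2) this j(4)] show ?thesis
    unfolding whisk_assoc nf.simps j(1) using sgn.distinct by blast
next
  case (lwhisk_lwhisk k l a b r)
  then have w: "wft (LWhisk l b r)" "wft (LWhisk k a r)" using assms by simp_all
  from w(1) obtain i where i: "l = Suc i" "i < n" "wft r"
    "wcomp F Minus (Suc i) (Suc n) (Old b) (New (cl r))"
    by (rule wft_LWhiskE)
  from w(2) obtain j where j: "k = Suc j" "wcomp F Minus (Suc j) (Suc n) (Old a) (New (cl r))"
    by (rule wft_LWhiskE)
  have "j < i" using lwhisk_lwhisk i j by simp
  from nf_act_distrib[OF i(3) this i(2,4) j(2)] show ?thesis
    unfolding lwhisk_lwhisk(1,2) nf.simps i(1) j(1) wcmp_Old .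
next
  case (lwhisk_rwhisk k l a b r)
  then have w: "wft (RWhisk l r b)" "wft (LWhisk k a r)" using assms by simp_all
  from w(1) obtain i where i: "l = Suc i" "i < n" "wft r"
    "wcomp F Plus (Suc i) (Suc n) (Old b) (New (cl r))"
    by (rule wft_RWhiskE)
  from w(2) obtain j where j: "k = Suc j" "wcomp F Minus (Suc j) (Suc n) (Old a) (New (cl r))"
    by (rule wft_LWhiskE)
  have "j < i" using lwhisk_rwhisk i j by simp
  from nf_act_distrib[OF i(3) this i(2,4) j(2)] show ?thesis
    unfolding lwhisk_rwhisk(1,2) nf.simps i(1) j(1) wcmp_Old .
next
  case (rwhisk_lwhisk k l b a r)
  then have w: "wft (LWhisk l b r)" "wft (RWhisk k r a)" using assms by simp_all
  from w(1) obtain i where i: "l = Suc i" "i < n" "wft r"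
    "wcomp F Minus (Suc i) (Suc n) (Old b) (New (cl r))"
    by (rule wft_LWhiskE)
  from w(2) obtain j where j: "k = Suc j" "wcomp F Plus (Suc j) (Suc n) (Old a) (New (cl r))"
    by (rule wft_RWhiskE)
  have "j < i" using rwhisk_lwhisk i j by simp
  from nf_act_distrib[OF i(3) this i(2,4) j(2)] show ?thesis
    unfolding rwhisk_lwhisk(1,2) nf.simps i(1) j(1) wcmp_Old .
next
  case (rwhisk_rwhisk k l b a r)
  then have w: "wft (RWhisk l r b)" "wft (RWhisk k r a)" using assms by simp_all
  from w(1) obtain i where i: "l = Suc i" "i < n" "wft r"
    "wcomp F Plus (Suc i) (Suc n) (Old b) (New (cl r))"
    by (rule wft_RWhiskE)
  from w(2) obtain j where j: "k = Suc j" "wcomp F Plus (Suc j) (Suc n) (Old a) (New (cl r))"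
    by (rule wft_RWhiskE)
  have "j < i" using rwhisk_rwhisk i j by simp
  from nf_act_distrib[OF i(3) this i(2,4) j(2)] show ?thesis
    unfolding rwhisk_rwhisk(1,2) nf.simps i(1) j(1) wcmp_Old .
qed simp_all

lemma term_eq_nf: "teq s t \<Longrightarrow> nf s = nf t"
  by (induction rule: term_eq.induct) (auto dest: term_ax_nf)

text \<open>The choice of the representative does not matter, by \<open>term_eq_nf\<close>; the
  value at \<open>Old\<close> cells is a dummy.\<close>

definition nfc :: "'a fcell \<Rightarrow> ((sgn \<Rightarrow> nat \<Rightarrow> 'a fcell) \<times> 'a) list" where
  "nfc u = (case u of Old a \<Rightarrow> [] | New X \<Rightarrow> nf (term_rep X))"

lemma nfc_cl [simp]: "wft t \<Longrightarrow> nfc (New (cl t)) = nf t"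
  using term_eq_nf[OF rep_cl[of t]] by (simp add: nfc_def)

lemma nfc_wcmp:
  assumes "wcomp F e (Suc j) (Suc n) a u" "j < n"
  shows "nfc (wcmp F e (Suc j) (Suc n) a u) = map (apfst (act F n e (Suc j) a)) (nfc u)"
proof (cases e)
  case Minus
  then have "composable F (Suc j) (Suc n) a u" using assms by (simp add: wcomp_def)
  then obtain b t where "a = Old b" "u = New (cl t)" "wft (LWhisk (Suc j) b t)"
    using assms(2) by (cases rule: F_composable_cases) auto
  moreover then have "wft t" by simp
  ultimately show ?thesis using Minus by (simp add: wcmp_def del: wf_term.simps(3))
next
  case Plus
  then have "composable F (Suc n) (Suc j) u a" using assms by (simp add: wcomp_def)
  then obtain b t where "a = Old b" "u = New (cl t)" "wft (RWhisk (Suc j) t b)"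
    using assms(2) by (cases rule: F_composable_cases) auto
  moreover then have "wft t" by simp
  ultimately show ?thesis using Plus by (simp add: wcmp_def del: wf_term.simps(4))
qed

lemma nfc_cmp:
  assumes "composable F (Suc n) (Suc n) u v"
  shows "nfc (cmp F (Suc n) (Suc n) u v) = nfc u @ nfc v"
proof -
  obtain s t where uv: "u = New (cl s)" "v = New (cl t)" and w: "wft (Comp s t)"
    using assms by (cases rule: F_composable_cases) auto
  then have "wft s" "wft t" by simp_all
  then show ?thesis using uv w by (simp del: wf_term.simps(5))
qed

section \<open>Reading the whiskers back from a composite\<close>

lemma nfc_comps: "comps F n us u \<Longrightarrow> nfc u = concat (map nfc us)"
proof (induction rule: comps.induct)
  case (nil a)
  then show ?case by (cases rule: F_cell_cases) auto
qed (simp add: nfc_cmp)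

text \<open>Induction with \<open>fill_Suc\<close>: the normal form of a partly whiskered generator
  shows the whiskers applied so far, followed by identities. At \<open>j = n\<close> no identities
  are left, and the family itself is recovered in dimensions \<open>1\<close> to
  \<open>n\<close>.\<close>

lemma nfc_whisk:
  assumes "A \<in> cells C (Suc n)" "j \<le> n" "whisk_defined F (Suc n) z (gen A) j"
  shows "nfc (whisk F (Suc n) z (gen A) j) =
    [(fill F (Suc n) n z j (whisk F (Suc n) z (gen A) j), A)]"
  using assms
proof (induction j)
  case 0
  then show ?case by (simp add: fill_0_cong[of F "Suc n" n undefined _ z])
next
  case (Suc j)
  then have c: "wcomp F Minus (Suc j) (Suc n) (z Minus (Suc j)) (whisk F (Suc n) z (gen A) j)"
    "wcomp F Plus (Suc j) (Suc n) (z Plus (Suc j))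
      (wcmp F Minus (Suc j) (Suc n) (z Minus (Suc j)) (whisk F (Suc n) z (gen A) j))"
    and d: "whisk_defined F (Suc n) z (gen A) j"
    unfolding whisk_defined_Suc by auto
  have "nfc (whisk F (Suc n) z (gen A) (Suc j)) =
    map (apfst (act F n Plus (Suc j) (z Plus (Suc j))))
      (map (apfst (act F n Minus (Suc j) (z Minus (Suc j)))) (nfc (whisk F (Suc n) z (gen A) j)))"
    unfolding whisk_Suc using c Suc.prems by (simp add: nfc_wcmp)
  then show ?case
    using Suc d F.fill_Suc[of n j z "gen A"] by simp
qed


section \<open>Decompositions\<close>

definition family :: "(nat \<Rightarrow> 'a) \<Rightarrow> (nat \<Rightarrow> 'a) \<Rightarrow> sgn \<Rightarrow> nat \<Rightarrow> 'a fcell" where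
  "family v w e i = free_incl n C i (case e of Minus \<Rightarrow> v i | Plus \<Rightarrow> w i)"

text \<open>The value \<open>undefined\<close> outside dimensions \<open>1\<close> to
  \<open>n\<close> is that of \<open>fill\<close>, so that normal forms and codes can be equal as
  functions.\<close>

definition code :: "(nat \<Rightarrow> 'a) \<times> 'a \<times> (nat \<Rightarrow> 'a) \<Rightarrow> (sgn \<Rightarrow> nat \<Rightarrow> 'a fcell) \<times> 'a" where
  "code = (\<lambda>(v, A, w). (\<lambda>e i. if i = 0 \<or> n < i then undefined else family v w e i, A))"

text \<open>In dimensions \<open>1\<close> to \<open>n\<close> the inclusion is the injective
  constructor \<open>Old\<close>; elsewhere the functions are fixed by extensionality.\<close>

lemma code_inj: "inj_on code (whisker_data n C)"
proof (rule inj_onI)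
  fix d d' assume "d \<in> whisker_data n C" "d' \<in> whisker_data n C" "code d = code d'"
  moreover obtain v A w where dv: "d = (v, A, w)" by (rule prod_cases3)
  moreover obtain v' A' w' where dv': "d' = (v', A', w')" by (rule prod_cases3)
  ultimately have d: "(v, A, w) \<in> whisker_data n C" "(v', A', w') \<in> whisker_data n C"
    and eq: "code (v, A, w) = code (v', A', w')" by auto
  have "family v w e i = family v' w' e i" if "i \<in> {1..n}" for e i
    using fun_cong[OF fun_cong[OF arg_cong[OF eq, of fst]], of e i] that by (simp add: code_def)
  from this[of _ Minus] this[of _ Plus]
  have "v i = v' i" "w i = w' i" if "i \<in> {1..n}" for i
    using that by (auto simp: family_def free_incl_def)
  moreover have "v \<in> PiE {1..n} (cells C)" "v' \<in> PiE {1..n} (cells C)"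
    "w \<in> PiE {1..n} (cells C)" "w' \<in> PiE {1..n} (cells C)"
    using d by (simp_all add: whisker_data_def)
  ultimately have "v = v'" "w = w'" by (simp_all only: PiE_ext)
  then show "d = d'" using eq dv dv' by (simp add: code_def)
qed

lemma val_code:
  "val (code (v, A, w)) =
    whisker F (Suc n) (\<lambda>j. free_incl n C j (v j)) (free_incl n C (Suc n) A)
      (\<lambda>j. free_incl n C j (w j)) n"
  and valid_code: "valid (code (v, A, w)) \<longleftrightarrow> A \<in> cells C (Suc n) \<and>
    whisker_defined F (Suc n) (\<lambda>j. free_incl n C j (v j)) (free_incl n C (Suc n) A)
      (\<lambda>j. free_incl n C j (w j)) n"
proof -
  have z: "fst (code (v, A, w)) e i = family v w e i" if "0 < i" "i \<le> n" for e i
    using that by (simp add: code_def)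
  have f: "family v w Minus = (\<lambda>j. free_incl n C j (v j))"
    "family v w Plus = (\<lambda>j. free_incl n C j (w j))"
    by (simp_all add: family_def fun_eq_iff)
  have A: "snd (code (v, A, w)) = A" "free_incl n C (Suc n) A = gen A"
    by (simp_all add: code_def free_incl_def)
  show "val (code (v, A, w)) =
      whisker F (Suc n) (\<lambda>j. free_incl n C j (v j)) (free_incl n C (Suc n) A)
        (\<lambda>j. free_incl n C j (w j)) n"
    using whisk_cong(1)[of n "fst (code (v, A, w))" "family v w" F "Suc n" "gen A", OF z]
    unfolding A f by simp
  show "valid (code (v, A, w)) \<longleftrightarrow> A \<in> cells C (Suc n) \<and>
      whisker_defined F (Suc n) (\<lambda>j. free_incl n C j (v j)) (free_incl n C (Suc n) A)
        (\<lambda>j. free_incl n C j (w j)) n"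
    using whisk_cong(2)[of n "fst (code (v, A, w))" "family v w" F "Suc n" "gen A", OF z]
    unfolding valid_def A f by simp
qed

text \<open>The case distinction on the empty list in \<open>decomposes\<close> is absorbed by
  \<open>comps\<close>.\<close>

lemma decomposes_iff:
  assumes "set ds \<subseteq> whisker_data n C"
  shows "decomposes n C u ds \<longleftrightarrow>
    (\<forall>d\<in>set ds. valid (code d)) \<and> comps F n (map (val \<circ> code) ds) u"
proof -
  let ?W = "\<lambda>(v, A, w). whisker F (Suc n) (\<lambda>j. free_incl n C j (v j)) (free_incl n C (Suc n) A)
      (\<lambda>j. free_incl n C j (w j)) n"
  let ?D = "\<lambda>(v, A, w). whisker_defined F (Suc n) (\<lambda>j. free_incl n C j (v j))
      (free_incl n C (Suc n) A) (\<lambda>j. free_incl n C j (w j)) n"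
  have W: "?W = val \<circ> code"
    using val_code by (auto simp: fun_eq_iff)
  \<comment> \<open>\<open>valid\<close> also asks that \<open>A\<close> be a generator, which
    \<open>whisker_data\<close> provides.\<close>
  have D: "(\<forall>d\<in>set ds. ?D d) \<longleftrightarrow> (\<forall>d\<in>set ds. valid (code d))"
    using assms valid_code by (force simp: whisker_data_def)
  show ?thesis
  proof (cases "ds = []")
    case True
    then show ?thesis
      by (auto simp: decomposes_def Let_def intro: comps.nil elim: comps.cases)
  next
    case False
    have "val (code d) \<in> cells F (Suc n)" if "valid (code d)" for d
      using that F.whisk_cell[of n] by (simp add: valid_def)
    then show ?thesis
      using False D F.comps_composite[of n "map (val \<circ> code) ds" u]
      unfolding decomposes_def Let_def W by auto
  qed
qed

section \<open>Uniqueness of decompositions\<close>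

lemma nfc_val:
  assumes "valid (code d)"
  shows "nfc (val (code d)) = [code d]"
proof -
  obtain v A w where d: "d = (v, A, w)" by (cases d)
  show ?thesis
    using nfc_whisk[of A n "fst (code d)"] assms
    by (simp add: fill_fill valid_def d) (auto simp: code_def fun_eq_iff)
qed

text \<open>The normal form of a composite concatenates those of its factors, each of which is a
  single code. As \<open>nfc u\<close> depends on \<open>u\<close> only, two decompositions of
  \<open>u\<close> have the same codes.\<close>

lemma decomposes_nfc:
  assumes "set ds \<subseteq> whisker_data n C" "decomposes n C u ds"
  shows "nfc u = map code ds"
proof -
  have "nfc u = concat (map (\<lambda>d. nfc (val (code d))) ds)"
    using assms nfc_comps[of "map (val \<circ> code) ds" u] by (simp add: decomposes_iff comp_def)
  also have "\<dots> = concat (map (\<lambda>d. [code d]) ds)"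
    using assms nfc_val by (intro arg_cong[of _ _ concat] map_cong) (auto simp: decomposes_iff)
  finally show ?thesis by simp
qed

section \<open>Existence of decompositions\<close>

lemma ex_code:
  assumes "valid d"
  shows "\<exists>d'\<in>whisker_data n C. valid (code d') \<and> val (code d') = val d"
proof -
  obtain z A where d: "d = (z, A)" by (cases d)
  have w: "whisk_defined F (Suc n) z (gen A) n" and A: "A \<in> cells C (Suc n)"
    using assms d by (auto simp: valid_def)
  \<comment> \<open>Whiskers have dimension at most \<open>n\<close>, where the cells of
    \<open>F\<close> are those of \<open>C\<close>.\<close>
  have old: "\<exists>a\<in>cells C i. z e i = Old a" if "i \<in> {1..n}" for e i
  proof -
    have "z e i \<in> cells F i" using F.whisk_fits[OF _ w] that unfolding F.fits_def by auto
    then show ?thesis by (cases rule: F_cell_cases) (use that in auto)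
  qed
  define y where "y e i = (SOME a. a \<in> cells C i \<and> z e i = Old a)" for e i
  have y: "y e i \<in> cells C i \<and> z e i = Old (y e i)" if "i \<in> {1..n}" for e i
    unfolding y_def by (rule someI_ex) (use old[OF that] in blast)
  \<comment> \<open>The restriction makes both functions extensional, as \<open>whisker_data\<close>
    demands.\<close>
  let ?d = "(restrict (y Minus) {1..n}, A, restrict (y Plus) {1..n})"
  have z: "z e i = fst (code ?d) e i" if "0 < i" "i \<le> n" for e i
    using y[of i e] that by (cases e) (auto simp: code_def family_def free_incl_def)
  have "?d \<in> whisker_data n C" using y A by (auto simp: whisker_data_def)
  moreover have "snd (code ?d) = A" by (simp add: code_def)
  ultimately show ?thesis
    using whisk_cong[of n z "fst (code ?d)" F "Suc n" "gen A", OF z] w A d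
    by (intro bexI[of _ ?d]) (auto simp: valid_def)
qed

lemma ex_decomposes:
  assumes "wft t"
  shows "\<exists>ds. set ds \<subseteq> whisker_data n C \<and> decomposes n C (New (cl t)) ds"
proof -
  have c: "\<forall>d\<in>set (nf t). valid d" "comps F n (map val (nf t)) (New (cl t))"
    using nf_comps[OF assms] by auto
  have "\<forall>d\<in>set (nf t). \<exists>d'. d' \<in> whisker_data n C \<and> valid (code d') \<and> val (code d') = val d"
    using c(1) ex_code by blast
  then obtain g where g: "\<And>d. d \<in> set (nf t) \<Longrightarrow>
      g d \<in> whisker_data n C \<and> valid (code (g d)) \<and> val (code (g d)) = val d"
    by metis
  have m: "map (val \<circ> code) (map g (nf t)) = map val (nf t)" using g by simp
  have "comps F n (map (val \<circ> code) (map g (nf t))) (New (cl t))" unfolding m by (rule c(2))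
  moreover have sub: "set (map g (nf t)) \<subseteq> whisker_data n C"
    and "\<forall>d\<in>set (map g (nf t)). valid (code d)" using g by auto
  ultimately show ?thesis using decomposes_iff[OF sub] by blast
qed

end

theorem mainTheorem2:
  fixes n :: nat and C :: "'a precat" and u :: "'a fcell"
  assumes "precategory n C"
    and "globular_set (Suc n) C"
    and "u \<in> cells (free_precat n C) (Suc n)"
  shows "\<exists>!ds. set ds \<subseteq> whisker_data n C \<and> decomposes n C u ds"
proof -
  interpret precategory_plus n C using assms(1,2) by (rule precategory_plus.intro)
  obtain t where t: "u = New (cl t)" "wft t" using assms(3) by (cases rule: F_cell_cases) auto
  show ?thesis
  proof (rule ex_ex1I)
    show "\<exists>ds. set ds \<subseteq> whisker_data n C \<and> decomposes n C u ds"
      using ex_decomposes t by simp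
  next
    fix ds ds'
    assume ds: "set ds \<subseteq> whisker_data n C \<and> decomposes n C u ds"
      and ds': "set ds' \<subseteq> whisker_data n C \<and> decomposes n C u ds'"
    then have "map code ds = map code ds'" using decomposes_nfc by metis
    then show "ds = ds'"
      using ds ds' by (intro map_inj_on[of code]) (auto intro: inj_on_subset[OF code_inj])
  qed
qed

end
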